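(* Let $d\ge1$ and $n\ge2$ be fixed, let $\boldsymbol{q}^*\in S^{d-1}$, and let $\boldsymbol{x}_j^k$ ($k\ge1$, $1\le j\le n$) be i.i.d. $\mathrm{Normal}(0,I_d)$. Let $\xi_k^*=\operatorname{argmax}_{1\le j\le n}\boldsymbol{x}_j^k\cdot\boldsymbol{q}^*$ and, for each $m$, $\boldsymbol{\xi}^*=(\xi_1^*,\dots,\xi_m^* )$. Fix $f\in[0,1]$ and, for each $m\ge1$ with $fm\in\mathbb{Z}$, let $\boldsymbol{\xi}=\boldsymbol{\xi}^{(m)}$ be sampled, conditionally on the instances, uniformly from $$\{\boldsymbol{\xi}\in[n]^m:\ d_H(\boldsymbol{\xi},\boldsymbol{\xi}^* )/m=1-f\}.$$ Then, as $m\to\infty$ (through integers with $fm\in\mathbb{Z}$), $$\bar{\boldsymbol{x}}_{\boldsymbol{\xi}}\ \longrightarrow\ \frac{fn-1}{n-1}\,\mu\,\boldsymbol{q}^*\qquad\text{almost surely}.$$ When $f>1/n$, the limit is a positive multiple of $\boldsymbol{q}^*$, and consequently $\hat{\boldsymbol{q}}_a(\boldsymbol{\xi})\to\boldsymbol{q}^*$ almost surely.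
   Context: Notation: $[n]=\{1,\dots,n\}$; $\|\cdot\|$ is the Euclidean norm. An assignment is a vector $\boldsymbol{\xi}=(\xi_1,\dots,\xi_m)\in[n]^m$, selecting the instance $\boldsymbol{x}^k_{\xi_k}$ from each bag $k$ (bag $k$ consists of $\boldsymbol{x}_1^k,\dots,\boldsymbol{x}_n^k$). $d_H(\boldsymbol{\xi},\boldsymbol{\xi}^* )=\#\{k\in[m]:\xi_k\neq\xi_k^*\}$ is the Hamming distance. Define $$\bar{\boldsymbol{x}}_{\boldsymbol{\xi}}=\frac1m\sum_{k=1}^m\boldsymbol{x}^k_{\xi_k},\qquad \hat{\boldsymbol{q}}_a(\boldsymbol{\xi})=\frac{\bar{\boldsymbol{x}}_{\boldsymbol{\xi}}}{\|\bar{\boldsymbol{x}}_{\boldsymbol{\xi}}\|}.$$ The constant $\mu=\mu_n$ is $\mu=\mathbb{E}[\max_{1\le j\le n}X_j]$ for $X_1,\dots,X_n$ i.i.d. $\mathrm{Normal}(0,1)$. *)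

theory Defs
  imports "HOL-Probability.Probability"
begin

definition std_normal :: "real measure" where
  "std_normal = density lborel (\<lambda>t. ennreal (std_normal_density t))"

definition gauss_max_mean :: "nat \<Rightarrow> real" where
  "gauss_max_mean n =
    (\<integral>X. (MAX j\<in>{1..n}. X j) \<partial>(\<Pi>\<^sub>M j\<in>{1..n}. std_normal))"

text \<open>The density of Normal(0, I): the coordinates are independent standard normals.\<close>

definition std_gaussian_density :: "real ^ 'd \<Rightarrow> real" where
  "std_gaussian_density v = (\<Prod>i\<in>UNIV. std_normal_density (v $ i))"

text \<open>
  Bags and the instances in a bag are numbered from 1.  A realisation of the instances is a
  function \<open>y\<close> with \<open>y k j\<close> the instance number \<open>j\<close> of bag \<open>k\<close>; only
  the arguments \<open>k \<ge> 1\<close> and \<open>1 \<le> j \<le> n\<close> matter.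
\<close>

definition assignments :: "nat \<Rightarrow> nat \<Rightarrow> (nat \<Rightarrow> nat) set" where
  "assignments m n = {1..m} \<rightarrow>\<^sub>E {1..n}"

definition hamming_dist :: "nat \<Rightarrow> (nat \<Rightarrow> nat) \<Rightarrow> (nat \<Rightarrow> nat) \<Rightarrow> nat" where
  "hamming_dist m a b = card {k \<in> {1..m}. a k \<noteq> b k}"

definition assignment_mean ::
  "nat \<Rightarrow> (nat \<Rightarrow> nat \<Rightarrow> real ^ 'd) \<Rightarrow> (nat \<Rightarrow> nat) \<Rightarrow> real ^ 'd" where
  "assignment_mean m y a = (1 / real m) *\<^sub>R (\<Sum>k=1..m. y k (a k))"

definition assignment_direction ::
  "nat \<Rightarrow> (nat \<Rightarrow> nat \<Rightarrow> real ^ 'd) \<Rightarrow> (nat \<Rightarrow> nat) \<Rightarrow> real ^ 'd" where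
  "assignment_direction m y a = assignment_mean m y a /\<^sub>R norm (assignment_mean m y a)"

text \<open>
  If several instances of a bag attain the maximum, \<^const>\<open>arg_max_on\<close> picks one of them.  For
  Gaussian instances and a unit vector \<open>q\<close> this happens with probability zero.
\<close>

definition best_assignment ::
  "nat \<Rightarrow> nat \<Rightarrow> real ^ 'd \<Rightarrow> (nat \<Rightarrow> nat \<Rightarrow> real ^ 'd) \<Rightarrow> nat \<Rightarrow> nat" where
  "best_assignment m n q y = (\<lambda>k\<in>{1..m}. arg_max_on (\<lambda>j. y k j \<bullet> q) {1..n})"

definition accuracy_set ::
  "nat \<Rightarrow> nat \<Rightarrow> real \<Rightarrow> (nat \<Rightarrow> nat) \<Rightarrow> (nat \<Rightarrow> nat) set" where
  "accuracy_set m n f b =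
    {a \<in> assignments m n. real (hamming_dist m a b) / real m = 1 - f}"

text \<open>The sigma-algebra generated by the instances in the bags \<open>1, \<dots>, m\<close>.\<close>

definition instance_algebra ::
  "'a measure \<Rightarrow> nat \<Rightarrow> nat \<Rightarrow> (nat \<Rightarrow> nat \<Rightarrow> 'a \<Rightarrow> real ^ 'd) \<Rightarrow> 'a measure" where
  "instance_algebra M m n x =
    vimage_algebra (space M)
      (\<lambda>\<omega>. \<lambda>(k, j)\<in>{1..m} \<times> {1..n}. x k j \<omega>)
      (\<Pi>\<^sub>M i\<in>{1..m} \<times> {1..n}. borel)"

text \<open>
  \<open>X\<close> is a random element of the finite set \<open>T\<close> whose conditional distribution given the
  sub-sigma-algebra \<open>F\<close> is uniform on the random set \<open>S \<omega> \<subseteq> T\<close>.  The definition is meaningful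
  when \<open>S \<omega>\<close> is nonempty, since \<^const>\<open>pmf_of_set\<close> is unspecified on the empty set.
\<close>

definition cond_uniform ::
  "'a measure \<Rightarrow> 'a measure \<Rightarrow> 'b set \<Rightarrow> ('a \<Rightarrow> 'b set) \<Rightarrow> ('a \<Rightarrow> 'b) \<Rightarrow> bool" where
  "cond_uniform M F T S X \<longleftrightarrow>
    X \<in> measurable M (count_space T) \<and>
    (\<forall>A\<subseteq>T. AE \<omega> in M.
      real_cond_exp M F (indicator (X -` A \<inter> space M)) \<omega> =
      measure_pmf.prob (pmf_of_set (S \<omega>)) A)"

text \<open>
  The limit \<open>m \<rightarrow> \<infinity>\<close> through positive integers with \<open>f m\<close> an integer.  For irrational \<open>f\<close>
  there are no such integers and the filter is trivial.
\<close>

definition admissible_at_top :: "real \<Rightarrow> nat filter" where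
  "admissible_at_top f = inf sequentially (principal {m. 1 \<le> m \<and> f * real m \<in> \<int>})"

end

theory Submission
  imports Defs
begin

text \<open>
  If the labels of the bags were drawn independently, keeping the best label with probability \<open>f\<close> and
  otherwise choosing a wrong one uniformly, then the selected instances would be independent and
  identically distributed, and the claim would be a law of large numbers.  The mean of a selected
  instance is \<open>(f n - 1) / (n - 1)\<close> times the mean of the best instance, because the noisy label is a
  mixture of the best label and a uniform label (\<open>sum_label_weight\<close>), and a uniformly labelled
  instance has mean 0.  The mean of the best instance is \<open>gauss_max_mean n\<close> times \<open>q\<close>: the reflection
  that fixes \<open>q\<close> and reverses its orthogonal complement preserves the Gaussian law and the choice of
  the best instance (\<open>mean_best_inner\<close>).

  The actual assignment is uniform on a Hamming sphere instead.  That is the law of independent labels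
  conditioned on the number of wrong labels being equal to its mean \<open>(1 - f) m\<close>, an event of probability at
  least \<open>1 / (m + 1)\<close>.  So every probability grows at most by the factor \<open>m + 1\<close> in passing from
  independent labels to the uniform law (\<open>uniform_accuracy_le_product\<close>).  For independent labels the
  deviations of the mean have exponentially small probability, by Chernoff's bound and the
  exponential moments of Gaussian variables (\<open>deviation_probability_le\<close>).  The resulting bounds are
  summable over \<open>m\<close>, and the Borel-Cantelli lemma gives almost sure convergence
  (\<open>AE_deviation_small\<close>).  Summability is essential here, because the joint law of the assignments
  for different \<open>m\<close> is arbitrary.

  The directions converge because the limit is a positive multiple of \<open>q\<close> when \<open>f > 1 / n\<close>, the expected
  maximum of at least two standard normal variables being positive (\<open>gauss_max_mean_pos\<close>).
\<close>

section \<open>The uniform law on a Hamming sphere and independent labels\<close>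

text \<open>
  Up to the factor \<open>m ^ m\<close> these are the binomial probabilities with success probability \<open>r / m\<close>,
  cleared of denominators.  Consecutive terms satisfy
  \<open>b (s + 1) * ((s + 1) * (m - r)) = b s * ((m - s) * r)\<close>, and \<open>(s + 1) * (m - r)\<close> is at most
  \<open>r * (m - s)\<close> for \<open>s < r\<close> and at least that for \<open>s \<ge> r\<close>.  So the terms rise up to \<open>s = r\<close> and
  fall afterwards.
\<close>

lemma binomial_term_le_mode:
  fixes m r s :: nat
  assumes "r \<le> m"
  shows "(m choose s) * r ^ s * (m - r) ^ (m - s) \<le> (m choose r) * r ^ r * (m - r) ^ (m - r)"
proof -
  define b where "b s = (m choose s) * r ^ s * (m - r) ^ (m - s)" for s
  have ratio: "b (Suc s) * (Suc s * (m - r)) = b s * ((m - s) * r)" if "s < m" for s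
  proof -
    have "m - s = Suc (m - Suc s)" using that by simp
    then have power: "(m - r) ^ (m - s) = (m - r) * (m - r) ^ (m - Suc s)"
      by simp
    have choose: "Suc s * (m choose Suc s) = (m - s) * (m choose s)"
      by (simp only: binomial_absorption binomial_absorb_comp)
    have "b (Suc s) * (Suc s * (m - r)) =
        (Suc s * (m choose Suc s)) * r ^ Suc s * ((m - r) * (m - r) ^ (m - Suc s))"
      by (simp only: b_def mult_ac)
    also have "\<dots> = ((m - s) * (m choose s)) * r ^ Suc s * (m - r) ^ (m - s)"
      by (simp only: power choose)
    also have "\<dots> = b s * ((m - s) * r)"
      by (simp only: b_def power_Suc mult_ac)
    finally show ?thesis .
  qed
  have up: "b s \<le> b (Suc s)" if "s < r" for s
  proof (cases "r = m")
    case True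
    then have "b s = 0" using that by (simp add: b_def)
    then show ?thesis by simp
  next
    case False
    then have pos: "0 < Suc s * (m - r)" using assms by simp
    have "Suc s * (m - r) \<le> (m - s) * r"
      using mult_mono[of "Suc s" r "m - r" "m - s"] that by (simp add: mult.commute)
    then have "b s * (Suc s * (m - r)) \<le> b s * ((m - s) * r)" by (rule mult_left_mono) simp
    also have "\<dots> = b (Suc s) * (Suc s * (m - r))"
      using ratio[of s] that assms by (simp only:)
    finally show ?thesis using pos by (rule mult_right_le_imp_le)
  qed
  have down: "b (Suc s) \<le> b s" if "r \<le> s" for s
  proof (cases "s < m")
    case False
    then show ?thesis by (simp add: b_def binomial_eq_0)
  next
    case True
    then have pos: "0 < Suc s * (m - r)" using that by simp
    have "(m - s) * r \<le> Suc s * (m - r)"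
      using mult_mono[of "m - s" "m - r" r "Suc s"] that by (simp add: mult.commute)
    then have "b s * ((m - s) * r) \<le> b s * (Suc s * (m - r))" by (rule mult_left_mono) simp
    then have "b (Suc s) * (Suc s * (m - r)) \<le> b s * (Suc s * (m - r))"
      by (simp only: ratio[OF True])
    then show ?thesis using pos by (rule mult_right_le_imp_le)
  qed
  have "b s \<le> b r"
  proof (cases "s \<le> r")
    case True
    then show ?thesis
      by (induction s rule: inc_induct) (auto intro: order_trans[OF up])
  next
    case False
    then have "r \<le> s" by simp
    then show ?thesis
      by (induction s rule: dec_induct) (auto intro: order_trans[OF down])
  qed
  then show ?thesis by (simp add: b_def)
qed

text \<open>
  The \<open>m + 1\<close> binomial probabilities add up to 1, so the largest of them is at least \<open>1 / (m + 1)\<close>.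
\<close>

lemma binomial_mode_lower_bound:
  fixes m r :: nat and p :: real
  assumes "1 \<le> m" and "r \<le> m" and p: "p = real r / real m"
  shows "1 \<le> real (m + 1) * (real (m choose r) * p ^ r * (1 - p) ^ (m - r))"
proof -
  have m: "real m > 0" using assms by simp
  have 1: "1 - p = real (m - r) / real m"
    using assms m by (simp add: of_nat_diff field_simps)
  have summand: "real (m choose s) * p ^ s * (1 - p) ^ (m - s) =
      real ((m choose s) * r ^ s * (m - r) ^ (m - s)) / real m ^ m" if "s \<le> m" for s
  proof -
    have "real m ^ s * real m ^ (m - s) = real m ^ m"
      using that by (simp flip: power_add)
    then show ?thesis
      unfolding 1 unfolding p power_divide by simp
  qed
  have "1 = (p + (1 - p)) ^ m" by simp
  also have "\<dots> = (\<Sum>s\<le>m. real (m choose s) * p ^ s * (1 - p) ^ (m - s))"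
    by (rule binomial_ring)
  also have "\<dots> \<le> (\<Sum>s\<le>m. real (m choose r) * p ^ r * (1 - p) ^ (m - r))"
  proof (rule sum_mono)
    fix s assume "s \<in> {..m}"
    then show "real (m choose s) * p ^ s * (1 - p) ^ (m - s)
        \<le> real (m choose r) * p ^ r * (1 - p) ^ (m - r)"
      using binomial_term_le_mode[OF \<open>r \<le> m\<close>, of s] m assms
      by (subst (1 2) summand) (auto intro!: divide_right_mono simp flip: of_nat_mult of_nat_power)
  qed
  finally show ?thesis by simp
qed

text \<open>
  A point of the sphere is given by the set \<open>D\<close> of the \<open>r\<close> places where it disagrees with \<open>b\<close>
  and by one of \<open>n - 1\<close> wrong labels at each of these places.
\<close>

lemma card_hamming_sphere:
  assumes b: "b \<in> {1..m} \<rightarrow> {1..n}"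
  shows "card {a \<in> assignments m n. hamming_dist m a b = r} = (m choose r) * (n - 1) ^ r"
proof -
  let ?D = "{D. D \<subseteq> {1..m} \<and> card D = r}"
  define E where "E D = (\<Pi>\<^sub>E k\<in>{1..m}. if k \<in> D then {1..n} - {b k} else {b k})" for D
  have mismatch: "{k \<in> {1..m}. a k \<noteq> b k} = D" if "a \<in> E D" "D \<subseteq> {1..m}" for a D
    using that unfolding E_def by (auto simp: PiE_iff split: if_splits)
  have E_sub: "E D \<subseteq> assignments m n" if "D \<subseteq> {1..m}" for D
    unfolding E_def assignments_def using b by (intro PiE_mono) auto
  have "{a \<in> assignments m n. hamming_dist m a b = r} = (\<Union>D\<in>?D. E D)"
  proof (intro equalityI subsetI)
    fix a assume a: "a \<in> {a \<in> assignments m n. hamming_dist m a b = r}"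
    let ?M = "{k \<in> {1..m}. a k \<noteq> b k}"
    have "a \<in> E ?M" using a unfolding E_def assignments_def by (auto simp: PiE_iff)
    moreover have "?M \<in> ?D" using a by (auto simp: hamming_dist_def)
    ultimately show "a \<in> (\<Union>D\<in>?D. E D)" by blast
  next
    fix a assume "a \<in> (\<Union>D\<in>?D. E D)"
    then obtain D where "D \<subseteq> {1..m}" "card D = r" "a \<in> E D" by blast
    then show "a \<in> {a \<in> assignments m n. hamming_dist m a b = r}"
      using mismatch[of a D] E_sub[of D] unfolding hamming_dist_def by blast
  qed
  also have "card \<dots> = (\<Sum>D\<in>?D. card (E D))"
  proof (rule card_UN_disjoint)
    show "\<forall>D\<in>?D. finite (E D)"
      unfolding E_def by (auto intro!: finite_PiE)
    show "\<forall>D\<in>?D. \<forall>D'\<in>?D. D \<noteq> D' \<longrightarrow> E D \<inter> E D' = {}"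
      using mismatch by blast
  qed simp
  also have "\<dots> = (\<Sum>D\<in>?D. (n - 1) ^ r)"
  proof (rule sum.cong[OF refl])
    fix D assume D: "D \<in> ?D"
    have "card (E D) = (\<Prod>k\<in>{1..m}. if k \<in> D then n - 1 else 1)"
      unfolding E_def
    proof (subst card_PiE)
      show "(\<Prod>k\<in>{1..m}. card (if k \<in> D then {1..n} - {b k} else {b k})) =
          (\<Prod>k\<in>{1..m}. if k \<in> D then n - 1 else 1)"
      proof (rule prod.cong[OF refl])
        fix k assume "k \<in> {1..m}"
        then have "b k \<in> {1..n}" using b by blast
        then show "card (if k \<in> D then {1..n} - {b k} else {b k}) = (if k \<in> D then n - 1 else 1)"
          by (simp add: card_Diff_singleton)
      qed
    qed simp
    also have "\<dots> = (n - 1) ^ card D"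
      using D by (simp add: prod.If_cases Int_absorb1)
    finally show "card (E D) = (n - 1) ^ r" using D by simp
  qed
  also have "\<dots> = (m choose r) * (n - 1) ^ r"
    by (simp add: n_subsets)
  finally show ?thesis .
qed

text \<open>
  The law of a single noisy label: the best label \<open>b\<close> is kept with probability \<open>f\<close> and otherwise
  replaced by a uniformly chosen wrong one.
\<close>

definition label_weight :: "real \<Rightarrow> nat \<Rightarrow> nat \<Rightarrow> nat \<Rightarrow> real" where
  "label_weight f n b j = (if j = b then f else (1 - f) / (real n - 1))"

lemma label_weight_nonneg:
  assumes "f \<in> {0..1}" and "n \<ge> 2"
  shows "0 \<le> label_weight f n b j"
  using assms by (simp add: label_weight_def)

text \<open>
  The noisy law is a multiple of the point mass at \<open>b\<close> plus a multiple of the uniform law on all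
  labels.  The coefficient of the point mass is the factor that appears in the limit.
\<close>

lemma sum_label_weight:
  fixes v :: "nat \<Rightarrow> real"
  assumes "n \<ge> 2" and "b \<in> {1..n}"
  shows "(\<Sum>j=1..n. label_weight f n b j * v j) =
    (f * real n - 1) / (real n - 1) * v b + (1 - f) / (real n - 1) * (\<Sum>j=1..n. v j)"
proof -
  have "label_weight f n b j * v j =
      (if j = b then (f - (1 - f) / (real n - 1)) * v b else 0) + (1 - f) / (real n - 1) * v j" for j
    by (simp add: label_weight_def algebra_simps)
  moreover have "f - (1 - f) / (real n - 1) = (f * real n - 1) / (real n - 1)"
    using assms by (simp add: field_simps)
  ultimately show ?thesis
    using assms by (simp add: sum.distrib sum.delta sum_distrib_left)
qed

lemma finite_assignments: "finite (assignments m n)"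
  by (simp add: assignments_def finite_PiE)

text \<open>
  Draw the labels of the \<open>m\<close> bags independently from \<^const>\<open>label_weight\<close>.  The number of wrong labels
  is then binomial with the integer mean \<open>r = (1 - f) * m\<close>, so with probability at least
  \<open>1 / (m + 1)\<close> it equals \<open>r\<close>; given that, the assignment is uniform on the sphere of radius \<open>r\<close>.
  Hence passing from the uniform law on the sphere to independent labels costs a factor of at most
  \<open>m + 1\<close>, which any exponentially small probability absorbs.
\<close>

lemma uniform_accuracy_le_product:
  assumes m: "1 \<le> m" and n: "2 \<le> n" and f: "f \<in> {0..1}" and fm: "f * real m \<in> \<int>"
    and b: "b \<in> {1..m} \<rightarrow> {1..n}" and a: "a \<in> assignments m n"
  shows "measure_pmf.prob (pmf_of_set (accuracy_set m n f b)) {a}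
    \<le> real (m + 1) * (\<Prod>k=1..m. label_weight f n (b k) (a k))"
proof -
  have "(1 - f) * real m \<in> \<int>" using fm by (simp add: algebra_simps)
  then obtain i where i: "(1 - f) * real m = of_int i" by (auto elim: Ints_cases)
  define r where "r = nat i"
  have "0 \<le> (1 - f) * real m" using f by simp
  then have r: "real r = (1 - f) * real m" unfolding r_def using i by simp
  have "(1 - f) * real m \<le> 1 * real m" using f by (intro mult_right_mono) auto
  then have "r \<le> m" using r by simp
  have p: "1 - f = real r / real m" using r m by simp
  let ?S = "{a \<in> assignments m n. hamming_dist m a b = r}"
  have S: "accuracy_set m n f b = ?S"
    unfolding accuracy_set_def p using m by auto
  have card: "card ?S = (m choose r) * (n - 1) ^ r"
    by (rule card_hamming_sphere[OF b])
  then have "card ?S > 0" using n \<open>r \<le> m\<close> by simp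
  then have ne: "?S \<noteq> {}" and fin: "finite ?S" by (auto simp: card_gt_0_iff)
  show ?thesis
  proof (cases "a \<in> ?S")
    case False
    have "0 \<le> (\<Prod>k=1..m. label_weight f n (b k) (a k))"
      by (intro prod_nonneg) (simp add: label_weight_nonneg[OF f n])
    then show ?thesis
      using False ne fin by (simp add: S measure_pmf_of_set)
  next
    case True
    let ?c = "real ((m choose r) * (n - 1) ^ r)"
    have "(\<Prod>k=1..m. label_weight f n (b k) (a k)) =
        (\<Prod>k=1..m. if a k \<noteq> b k then (1 - f) / (real n - 1) else f)"
      by (intro prod.cong) (auto simp: label_weight_def)
    also have "\<dots> = ((1 - f) / (real n - 1)) ^ r * f ^ (m - r)"
    proof -
      have "card {k \<in> {1..m}. a k = b k} = m - card {k \<in> {1..m}. a k \<noteq> b k}"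
      proof -
        have "{k \<in> {1..m}. a k = b k} = {1..m} - {k \<in> {1..m}. a k \<noteq> b k}" by auto
        moreover have "card ({1..m} - {k \<in> {1..m}. a k \<noteq> b k}) =
            card {1..m} - card {k \<in> {1..m}. a k \<noteq> b k}"
          by (rule card_Diff_subset) auto
        ultimately show ?thesis by (metis card_atLeastAtMost diff_Suc_1)
      qed
      then show ?thesis using True
        by (simp add: prod.If_cases hamming_dist_def Int_def)
    qed
    finally have w: "(\<Prod>k=1..m. label_weight f n (b k) (a k)) =
        ((1 - f) / (real n - 1)) ^ r * f ^ (m - r)" .
    have "1 \<le> real (m + 1) * (real (m choose r) * (1 - f) ^ r * f ^ (m - r))"
      using binomial_mode_lower_bound[OF m \<open>r \<le> m\<close> p] by simp
    also have "\<dots> = (real (m + 1) * (\<Prod>k=1..m. label_weight f n (b k) (a k))) * ?c"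
      unfolding w using n by (simp add: power_divide of_nat_diff)
    finally have "1 / ?c \<le> real (m + 1) * (\<Prod>k=1..m. label_weight f n (b k) (a k))"
      using n \<open>r \<le> m\<close> by (subst pos_divide_le_eq) (auto simp del: of_nat_mult of_nat_power)
    moreover have "measure_pmf.prob (pmf_of_set (accuracy_set m n f b)) {a} = 1 / ?c"
      using True ne fin card by (simp add: S measure_pmf_of_set)
    ultimately show ?thesis by simp
  qed
qed

section \<open>Standard Gaussian vectors\<close>

definition std_gaussian :: "(real ^ 'd) measure" where
  "std_gaussian = density lborel (\<lambda>v. ennreal (std_gaussian_density v))"

text \<open>
  The density depends on the vector through its norm only, which is what makes the Gaussian law
  invariant under orthogonal maps.
\<close>

lemma std_gaussian_density_eq_norm:
  fixes v :: "real ^ 'd"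
  shows "std_gaussian_density v = (1 / sqrt (2 * pi)) ^ CARD('d) * exp (- (norm v)\<^sup>2 / 2)"
proof -
  have "(\<Sum>i\<in>UNIV. - (v $ i)\<^sup>2 / 2) = - (norm v)\<^sup>2 / 2"
    by (simp add: norm_eq_sqrt_inner inner_vec_def sum_nonneg power2_eq_square
        sum_negf flip: sum_divide_distrib)
  then show ?thesis
    unfolding std_gaussian_density_def std_normal_density_def prod.distrib
    by (simp flip: exp_sum)
qed

lemma borel_measurable_orthogonal:
  fixes T :: "'v::euclidean_space \<Rightarrow> 'v"
  assumes "orthogonal_transformation T"
  shows "T \<in> borel_measurable borel"
  using assms by (intro borel_measurable_continuous_onI linear_continuous_on
      linear_conv_bounded_linear[THEN iffD1] orthogonal_transformation_linear)

lemma nn_integral_lborel_shift: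
  fixes g :: "'v::euclidean_space \<Rightarrow> ennreal"
  assumes [measurable]: "g \<in> borel_measurable borel"
  shows "(\<integral>\<^sup>+ y. g (c + y) \<partial>lborel) = (\<integral>\<^sup>+ y. g y \<partial>lborel)"
  by (subst (2) lborel_distr_plus[symmetric, of c]) (simp add: nn_integral_distr)

text \<open>
  Let \<open>\<nu>\<close> be the image of Lebesgue measure \<open>\<lambda>\<close> under \<open>T\<close> and let \<open>B\<close> be the unit ball.  The double integral
  of \<open>indicator A x * indicator B (T y - x)\<close> over \<open>x\<close> and \<open>y\<close> can be computed in both orders.
  Integrating over \<open>y\<close> first and shifting \<open>y\<close> by \<open>inv T x\<close> gives \<open>\<lambda> A * \<lambda> B\<close>, because \<open>T\<close> preserves \<open>B\<close>.
  Shifting \<open>x\<close> by \<open>T y\<close> and then integrating over \<open>y\<close> first gives \<open>\<lambda> B * \<nu> A\<close>.  Since \<open>\<lambda> B\<close> is positive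
  and finite, it cancels.
\<close>

lemma distr_lborel_orthogonal:
  fixes T :: "'v::euclidean_space \<Rightarrow> 'v"
  assumes T: "orthogonal_transformation T"
  shows "distr lborel borel T = lborel"
proof (rule measure_eqI)
  fix A assume "A \<in> sets (distr lborel borel T)"
  then have [measurable]: "A \<in> sets borel" by simp
  note [measurable] = borel_measurable_orthogonal[OF T]
  note lin = orthogonal_transformation_linear[OF T]
  define B :: "'v set" where "B = ball 0 1"
  have B_iff: "v \<in> B \<longleftrightarrow> norm v < 1" for v
    by (simp add: B_def)
  have [measurable]: "B \<in> sets borel"
    by (simp add: B_def)
  have T_inv: "T (inv T x) = x" for x
    using orthogonal_transformation_surj[OF T] by (simp add: surj_f_inv_f)
  have y_first: "(\<integral>\<^sup>+ y. indicator A x * indicator B (T y - x) \<partial>lborel) =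
      indicator A x * emeasure lborel B" for x
  proof -
    have "(\<integral>\<^sup>+ y. indicator B (T y - x) \<partial>lborel) =
        (\<integral>\<^sup>+ y. indicator B (T (inv T x + y) - x) \<partial>lborel)"
      by (rule nn_integral_lborel_shift[symmetric]) measurable
    also have "\<dots> = (\<integral>\<^sup>+ y. indicator B y \<partial>lborel)"
      by (intro nn_integral_cong)
         (simp add: linear_add[OF lin] T_inv indicator_def B_iff orthogonal_transformation_norm[OF T])
    finally show ?thesis
      by (simp add: nn_integral_cmult)
  qed
  have x_first: "(\<integral>\<^sup>+ x. indicator A x * indicator B (T y - x) \<partial>lborel) =
      (\<integral>\<^sup>+ x. indicator B x * indicator A (T y + x) \<partial>lborel)" for y
  proof -
    have "(\<integral>\<^sup>+ x. indicator A x * indicator B (T y - x) \<partial>lborel) =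
        (\<integral>\<^sup>+ x. indicator A (T y + x) * indicator B (T y - (T y + x)) \<partial>lborel)"
      by (rule nn_integral_lborel_shift[symmetric]) measurable
    then show ?thesis
      by (simp add: indicator_def B_iff mult.commute)
  qed
  have image: "(\<integral>\<^sup>+ y. indicator A (T y + x) \<partial>lborel) = emeasure (distr lborel borel T) A" for x
  proof -
    have "(\<integral>\<^sup>+ y. indicator A (T y) \<partial>lborel) =
        (\<integral>\<^sup>+ y. indicator A (T (inv T x + y)) \<partial>lborel)"
      by (rule nn_integral_lborel_shift[symmetric]) measurable
    also have "\<dots> = (\<integral>\<^sup>+ y. indicator A (T y + x) \<partial>lborel)"
      by (simp add: linear_add[OF lin] T_inv add.commute)
    finally show ?thesis
      by (simp add: nn_integral_distr flip: nn_integral_indicator)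
  qed
  have "emeasure lborel A * emeasure lborel B =
      (\<integral>\<^sup>+ x. \<integral>\<^sup>+ y. indicator A x * indicator B (T y - x) \<partial>lborel \<partial>lborel)"
    by (simp add: y_first nn_integral_multc)
  also have "\<dots> = (\<integral>\<^sup>+ y. \<integral>\<^sup>+ x. indicator A x * indicator B (T y - x) \<partial>lborel \<partial>lborel)"
    by (rule lborel_pair.Fubini') measurable
  also have "\<dots> = (\<integral>\<^sup>+ x. \<integral>\<^sup>+ y. indicator B x * indicator A (T y + x) \<partial>lborel \<partial>lborel)"
    unfolding x_first by (rule lborel_pair.Fubini') measurable
  also have "\<dots> = emeasure lborel B * emeasure (distr lborel borel T) A"
    by (simp add: nn_integral_cmult nn_integral_multc image)
  finally have "emeasure lborel B * emeasure lborel A =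
      emeasure lborel B * emeasure (distr lborel borel T) A"
    by (simp add: mult.commute)
  moreover have "emeasure lborel B \<noteq> 0"
    using emeasure_lborel_ball_finite[of "0::'v" 1, folded B_def] content_ball_pos[of 1 "0::'v", folded B_def]
    by (auto simp: measure_def)
  moreover have "emeasure lborel B \<noteq> \<infinity>"
    using emeasure_lborel_ball_finite[of "0::'v" 1] unfolding B_def by auto
  ultimately show "emeasure (distr lborel borel T) A = emeasure lborel A"
    by (auto simp: ennreal_mult_cancel_left)
qed simp

lemma borel_measurable_std_gaussian_density [measurable]:
  "std_gaussian_density \<in> borel_measurable borel"
  unfolding std_gaussian_density_def by measurable

lemma sets_std_gaussian [measurable_cong]: "sets std_gaussian = sets borel"
  by (simp add: std_gaussian_def)

lemma sets_std_normal [measurable_cong]: "sets std_normal = sets borel"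
  by (simp add: std_normal_def)

lemma space_std_normal [simp]: "space std_normal = UNIV"
  by (simp add: std_normal_def)

lemma prob_space_std_normal: "prob_space std_normal"
  unfolding std_normal_def by (rule prob_space_normal_density) simp

lemma distr_std_gaussian_orthogonal:
  fixes T :: "real ^ 'd \<Rightarrow> real ^ 'd"
  assumes T: "orthogonal_transformation T"
  shows "distr std_gaussian borel T = std_gaussian"
proof -
  note [measurable] = borel_measurable_orthogonal[OF T]
  have "std_gaussian_density v = std_gaussian_density (T v)" for v
    by (simp add: std_gaussian_density_eq_norm orthogonal_transformation_norm[OF T])
  then have "distr std_gaussian borel T =
      distr (density lborel (\<lambda>v. ennreal (std_gaussian_density (T v)))) borel T"
    by (simp add: std_gaussian_def)
  also have "\<dots> = density (distr lborel borel T) (\<lambda>v. ennreal (std_gaussian_density v))"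
    by (rule density_distr[symmetric]) auto
  finally show ?thesis
    by (simp add: distr_lborel_orthogonal[OF T] std_gaussian_def)
qed

text \<open>
  The density is a product over the coordinates, so the integral of \<open>indicator A (v $ i)\<close> factors; every
  factor except the one for coordinate \<open>i\<close> is a total mass, hence 1.
\<close>

lemma distr_std_gaussian_coordinate:
  "distr std_gaussian borel (\<lambda>v :: real ^ 'd. v $ i) = std_normal"
proof (rule measure_eqI)
  fix A assume "A \<in> sets (distr std_gaussian borel (\<lambda>v :: real ^ 'd. v $ i))"
  then have A [measurable]: "A \<in> sets borel" by simp
  let ?e = "\<lambda>j :: 'd. axis j (1 :: real)"
  define g :: "real ^ 'd \<Rightarrow> real \<Rightarrow> ennreal" where
    "g b t = ennreal (std_normal_density t) * (if b = ?e i then indicator A t else 1)" for b t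
  have g_meas [measurable]: "g b \<in> borel_measurable borel" for b
    unfolding g_def by measurable
  have basis: "Basis = range ?e" and inj: "inj ?e"
    by (auto simp: Basis_vec_def inj_on_def axis_eq_axis)
  have density: "ennreal (std_gaussian_density v) * indicator A (v $ i) =
      (\<Prod>b\<in>Basis. g b (v \<bullet> b))" for v :: "real ^ 'd"
  proof -
    have "(\<Prod>b\<in>Basis. g b (v \<bullet> b)) = (\<Prod>j\<in>UNIV. g (?e j) (v $ j))"
      unfolding basis by (subst prod.reindex[OF inj]) (simp add: inner_axis)
    also have "\<dots> = (\<Prod>j\<in>UNIV. ennreal (std_normal_density (v $ j)) *
        (if j = i then indicator A (v $ j) else 1))"
      by (simp add: g_def axis_eq_axis)
    also have "\<dots> = ennreal (std_gaussian_density v) * indicator A (v $ i)"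
      by (simp add: prod.distrib std_gaussian_density_def prod_ennreal prod.delta)
    finally show ?thesis by simp
  qed
  have one: "(\<integral>\<^sup>+ t. g b t \<partial>lborel) = (if b = ?e i then emeasure std_normal A else 1)" for b
  proof (cases "b = ?e i")
    case True
    then show ?thesis by (simp add: g_def std_normal_def emeasure_density)
  next
    case False
    then show ?thesis
      using prob_space.emeasure_space_1[OF prob_space_std_normal]
      by (simp add: g_def std_normal_def emeasure_density)
  qed
  have "emeasure (distr std_gaussian borel (\<lambda>v :: real ^ 'd. v $ i)) A =
      (\<integral>\<^sup>+ v. ennreal (std_gaussian_density v) * indicator A (v $ i) \<partial>(lborel :: (real ^ 'd) measure))"
  proof -
    have "(\<lambda>v. v $ i) -` A \<in> sets borel"
      by (rule measurable_sets_borel[OF _ A]) measurable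
    then show ?thesis
      by (simp add: std_gaussian_def emeasure_distr emeasure_density)
         (simp add: indicator_def vimage_def)
  qed
  also have "\<dots> = (\<Prod>b\<in>(Basis :: (real ^ 'd) set). \<integral>\<^sup>+ t. g b t \<partial>lborel)"
    unfolding density by (rule nn_integral_lborel_prod) auto
  also have "\<dots> = emeasure std_normal A"
    unfolding one by (simp add: prod.delta)
  finally show "emeasure (distr std_gaussian borel (\<lambda>v :: real ^ 'd. v $ i)) A =
      emeasure std_normal A" .
qed (simp add: sets_std_normal)

text \<open>
  Some orthogonal map takes \<open>u\<close> to a coordinate axis and leaves the Gaussian law unchanged.
\<close>

lemma distr_std_gaussian_inner:
  fixes u :: "real ^ 'd"
  assumes "norm u = 1"
  shows "distr std_gaussian borel (\<lambda>v. v \<bullet> u) = std_normal"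
proof -
  fix i :: 'd
  obtain T where T: "orthogonal_transformation T" and Tu: "T u = axis i (1 :: real)"
    using orthogonal_transformation_exists_1[of u "axis i 1"] assms by auto
  note [measurable] = borel_measurable_orthogonal[OF T]
  have "v \<bullet> u = T v $ i" for v
    using T Tu by (metis inner_axis' inner_commute mult_1 orthogonal_transformation_def
        inner_real_def)
  then have "distr std_gaussian borel (\<lambda>v. v \<bullet> u) = distr std_gaussian borel ((\<lambda>v. v $ i) \<circ> T)"
    by (simp add: comp_def)
  also have "\<dots> = distr (distr std_gaussian borel T) borel (\<lambda>v. v $ i)"
    by (subst distr_distr) auto
  finally show ?thesis
    by (simp add: distr_std_gaussian_orthogonal[OF T] distr_std_gaussian_coordinate)
qed

lemma integrable_std_normal_exp: "integrable std_normal (\<lambda>z. exp (s * z))"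
proof -
  \<comment> \<open>Completing the square turns the product into a shifted normal density.\<close>
  have eq: "std_normal_density z * exp (s * z) = exp (s\<^sup>2 / 2) * normal_density s 1 z" for z
    by (simp add: normal_density_def std_normal_density_def power2_eq_square field_simps
        flip: exp_add)
  show ?thesis
    unfolding std_normal_def by (subst integrable_density) (auto simp: eq)
qed

lemma
  shows integrable_std_normal_id: "integrable std_normal (\<lambda>z. z)"
    and integral_std_normal_id: "(\<integral>z. z \<partial>std_normal) = 0"
proof -
  show "integrable std_normal (\<lambda>z. z)"
    unfolding std_normal_def using integrable_normal_moment_nz_1[of 1 0]
    by (subst integrable_density) auto
  show "(\<integral>z. z \<partial>std_normal) = 0"
    unfolding std_normal_def using normal_moment_nz_1[of 1 0]
    by (subst integral_density) (auto simp: has_bochner_integral_iff)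
qed

section \<open>The expected maximum of standard normal variables\<close>

lemma emeasure_std_normal_interval_pos:
  fixes a b :: real
  assumes "a < b"
  shows "0 < emeasure std_normal {a<..<b}"
proof (rule ccontr)
  assume "\<not> 0 < emeasure std_normal {a<..<b}"
  then have "AE t in lborel. t \<notin> {a<..<b}"
    using normal_density_pos[of 1 0]
    by (simp add: std_normal_def emeasure_density nn_integral_0_iff_AE)
       (auto elim!: eventually_mono split: split_indicator_asm simp: less_le)
  then have "emeasure lborel {a<..<b} = 0"
    by (subst (asm) AE_iff_measurable[of "{a<..<b}"]) auto
  then show False using assms by simp
qed

text \<open>
  The maximum minus the first variable is nonnegative and has mean \<open>gauss_max_mean n\<close>.  It vanishes
  almost surely only if the second variable almost surely does not exceed the first, whereas the event
  that the first is in \<open>(-1, 0)\<close> and all others are in \<open>(0, 1)\<close> has positive probability.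
\<close>

lemma gauss_max_mean_pos:
  assumes n: "n \<ge> 2"
  shows "0 < gauss_max_mean n"
proof -
  let ?I = "{1..n}"
  let ?P = "\<Pi>\<^sub>M j\<in>?I. std_normal"
  interpret product_prob_space "\<lambda>_. std_normal" ?I
    by (rule product_prob_spaceI) (rule prob_space_std_normal)
  have ne: "?I \<noteq> {}" and one: "1 \<in> ?I" and two: "2 \<in> ?I" using n by auto
  \<comment> \<open>The mean of the first variable is 0, so subtracting it does not change the mean.\<close>
  define g where "g X = (MAX j\<in>?I. X j) - X 1" for X :: "nat \<Rightarrow> real"
  have comp_int: "integrable ?P (\<lambda>X. X j)" and comp_mean: "(\<integral>X. X j \<partial>?P) = 0" if "j \<in> ?I" for j
  proof -
    have law: "distr ?P std_normal (\<lambda>X. X j) = std_normal"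
      using that by (rule PiM_component)
    have meas: "(\<lambda>X. X j) \<in> measurable ?P std_normal"
      using that by (rule measurable_component_singleton)
    show "integrable ?P (\<lambda>X. X j)"
      using integrable_distr[OF meas, of "\<lambda>z. z", unfolded law] integrable_std_normal_id
      by (simp del: One_nat_def)
    show "(\<integral>X. X j \<partial>?P) = 0"
      using integral_distr[OF meas, of "\<lambda>z. z", unfolded law] integral_std_normal_id
      by (simp del: One_nat_def)
  qed
  have max_int: "integrable ?P (\<lambda>X. MAX j\<in>?I. X j)"
  proof (rule Bochner_Integration.integrable_bound)
    show "integrable ?P (\<lambda>X. \<Sum>j=1..n. \<bar>X j\<bar>)"
      using comp_int by (intro Bochner_Integration.integrable_sum integrable_abs) auto
    show "(\<lambda>X. MAX j\<in>?I. X j) \<in> borel_measurable ?P"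
      by (rule borel_measurable_Max[where f = "\<lambda>j X. X j"]) auto
    have "\<bar>MAX j\<in>?I. X j\<bar> \<le> (\<Sum>j=1..n. \<bar>X j\<bar>)" for X :: "nat \<Rightarrow> real"
    proof -
      have "(MAX j\<in>?I. X j) \<in> X ` ?I" using ne by (intro Max_in) auto
      then obtain i where "i \<in> ?I" "(MAX j\<in>?I. X j) = X i" by auto
      then show ?thesis by (simp only:) (rule member_le_sum; simp)
    qed
    then show "AE X in ?P. norm (MAX j\<in>?I. X j) \<le> norm (\<Sum>j=1..n. \<bar>X j\<bar>)"
      by (intro AE_I2) (auto intro: order_trans[OF _ abs_ge_self])
  qed
  have g_int: "integrable ?P g"
    unfolding g_def using max_int comp_int[OF one] by simp
  have g_mean: "(\<integral>X. g X \<partial>?P) = gauss_max_mean n"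
    unfolding g_def gauss_max_mean_def using max_int comp_int[OF one] comp_mean[OF one] by simp
  have g_nonneg: "0 \<le> g X" for X
    using one by (auto simp: g_def)
  let ?E = "\<lambda>j. if j = 1 then {-1<..<0} else {0<..<1} :: real set"
  have "(\<Prod>j\<in>?I. emeasure std_normal (?E j)) \<noteq> 0"
    using emeasure_std_normal_interval_pos[of "-1" 0] emeasure_std_normal_interval_pos[of 0 1]
    by auto
  then have box_pos: "0 < emeasure ?P (\<Pi>\<^sub>E j\<in>?I. ?E j)"
    by (subst emeasure_PiM) (auto simp: zero_less_iff_neq_zero)
  have "gauss_max_mean n \<noteq> 0"
  proof
    assume "gauss_max_mean n = 0"
    then have "AE X in ?P. g X = 0"
      using integral_nonneg_eq_0_iff_AE[OF g_int] g_nonneg g_mean by auto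
    then have "AE X in ?P. X \<notin> (\<Pi>\<^sub>E j\<in>?I. ?E j)"
    proof (rule eventually_mono)
      fix X assume "g X = 0"
      have "X 2 \<le> (MAX j\<in>?I. X j)" using two by (intro Max_ge) auto
      also have "\<dots> = X 1" using \<open>g X = 0\<close> by (simp add: g_def)
      finally have "X 2 \<le> X 1" .
      then show "X \<notin> (\<Pi>\<^sub>E j\<in>?I. ?E j)"
        using PiE_mem[OF _ one, of X ?E] PiE_mem[OF _ two, of X ?E] by auto
    qed
    moreover have "(\<Pi>\<^sub>E j\<in>?I. ?E j) \<in> sets ?P"
      by (intro sets_PiM_I_finite) auto
    ultimately have "emeasure ?P (\<Pi>\<^sub>E j\<in>?I. ?E j) = 0"
      by (simp only: AE_iff_null_sets[symmetric] null_sets_def mem_Collect_eq)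
    then show False using box_pos by simp
  qed
  moreover have "0 \<le> gauss_max_mean n"
    unfolding g_mean[symmetric] by (rule integral_nonneg_AE) (simp add: g_nonneg)
  ultimately show ?thesis by simp
qed

section \<open>Measurable choice of a maximiser\<close>

lemma
  fixes c :: "'i \<Rightarrow> real"
  assumes "finite S" and "S \<noteq> {}"
  shows arg_max_on_in: "arg_max_on c S \<in> S"
    and le_arg_max_on: "i \<in> S \<Longrightarrow> c i \<le> c (arg_max_on c S)"
proof -
  have "Max (c ` S) \<in> c ` S" using assms by (intro Max_in) auto
  then obtain x where "x \<in> S" "c x = Max (c ` S)" by auto
  then have "is_arg_max c (\<lambda>x. x \<in> S) x"
    using assms by (simp add: is_arg_max_linorder)
  then have "is_arg_max c (\<lambda>x. x \<in> S) (arg_max_on c S)"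
    unfolding arg_max_on_def arg_max_def by (rule someI)
  then show "arg_max_on c S \<in> S" and "i \<in> S \<Longrightarrow> c i \<le> c (arg_max_on c S)"
    by (auto simp: is_arg_max_linorder)
qed

text \<open>
  Even when there are ties, the chosen maximiser is a function of the set of all maximisers.  This
  set takes finitely many values, each on a measurable event, and so the choice is measurable.
\<close>

lemma arg_max_on_eq_some:
  fixes c :: "'i \<Rightarrow> real"
  shows "arg_max_on c S = (SOME x. x \<in> {j \<in> S. \<forall>i\<in>S. c i \<le> c j})"
  unfolding arg_max_on_def arg_max_def
  by (rule arg_cong[where f = Eps]) (auto simp: fun_eq_iff is_arg_max_linorder)

lemma arg_max_on_cong:
  fixes c c' :: "'i \<Rightarrow> real"
  assumes "\<And>i. i \<in> S \<Longrightarrow> c i = c' i"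
  shows "arg_max_on c S = arg_max_on c' S"
proof -
  have "{j \<in> S. \<forall>i\<in>S. c i \<le> c j} = {j \<in> S. \<forall>i\<in>S. c' i \<le> c' j}"
    using assms by auto
  then show ?thesis by (simp add: arg_max_on_eq_some)
qed

lemma measurable_arg_max_on:
  fixes c :: "'i \<Rightarrow> 'a \<Rightarrow> real"
  assumes S: "finite S" "S \<noteq> {}" and c [measurable]: "\<And>i. i \<in> S \<Longrightarrow> c i \<in> borel_measurable N"
  shows "(\<lambda>\<omega>. arg_max_on (\<lambda>i. c i \<omega>) S) \<in> measurable N (count_space S)"
proof -
  have "(\<lambda>\<omega>. {j \<in> S. \<forall>i\<in>S. c i \<omega> \<le> c j \<omega>}) \<in> measurable N (count_space (Pow S))"
  proof (subst measurable_count_space_eq2)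
    show "finite (Pow S)" using S by simp
    have "(\<lambda>\<omega>. {j \<in> S. \<forall>i\<in>S. c i \<omega> \<le> c j \<omega>}) -` {B} \<inter> space N \<in> sets N"
      if "B \<subseteq> S" for B
    proof -
      have "(\<lambda>\<omega>. {j \<in> S. \<forall>i\<in>S. c i \<omega> \<le> c j \<omega>}) -` {B} \<inter> space N =
          {\<omega> \<in> space N. \<forall>j\<in>S. (\<forall>i\<in>S. c i \<omega> \<le> c j \<omega>) = (j \<in> B)}"
        using that by auto
      also have "\<dots> \<in> sets N" using S(1) by measurable
      finally show ?thesis .
    qed
    then show "(\<lambda>\<omega>. {j \<in> S. \<forall>i\<in>S. c i \<omega> \<le> c j \<omega>}) \<in> space N \<rightarrow> Pow S \<and>
        (\<forall>B\<in>Pow S. (\<lambda>\<omega>. {j \<in> S. \<forall>i\<in>S. c i \<omega> \<le> c j \<omega>}) -` {B} \<inter> space N \<in> sets N)"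
      by auto
  qed
  then have "(\<lambda>\<omega>. SOME x. x \<in> {j \<in> S. \<forall>i\<in>S. c i \<omega> \<le> c j \<omega>}) \<in> measurable N (count_space UNIV)"
    by (rule measurable_compose) simp
  then have arg: "(\<lambda>\<omega>. arg_max_on (\<lambda>i. c i \<omega>) S) \<in> measurable N (count_space UNIV)"
    by (simp only: arg_max_on_eq_some)
  have "(\<lambda>\<omega>. arg_max_on (\<lambda>i. c i \<omega>) S) -` {a} \<inter> space N \<in> sets N" for a
    by (rule measurable_sets[OF arg]) simp
  then show ?thesis
    using arg_max_on_in[OF S] by (subst measurable_count_space_eq2[OF S(1)]) auto
qed

lemma borel_measurable_at_arg_max_on:
  fixes c h :: "'i \<Rightarrow> 'a \<Rightarrow> real"
  assumes S: "finite S" "S \<noteq> {}" and "\<And>i. i \<in> S \<Longrightarrow> c i \<in> borel_measurable N"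
    and "\<And>i. i \<in> S \<Longrightarrow> h i \<in> borel_measurable N"
  shows "(\<lambda>\<omega>. h (arg_max_on (\<lambda>i. c i \<omega>) S) \<omega>) \<in> borel_measurable N"
  by (rule measurable_compose_countable'[OF _ measurable_arg_max_on])
     (use assms in \<open>auto intro: countable_finite\<close>)

section \<open>The mean of the best instance of a bag\<close>

context prob_space
begin

text \<open>
  Independent families with the same marginal laws have the same joint law.  The assumption
  \<open>local\<close> says that \<open>g\<close> only looks at the coordinates in \<open>I\<close>.
\<close>

lemma integral_indep_family:
  fixes X :: "'i \<Rightarrow> 'a \<Rightarrow> 'b::topological_space" and g :: "('i \<Rightarrow> 'b) \<Rightarrow> real"
  assumes I: "I \<noteq> {}" and indep: "indep_vars (\<lambda>_. borel) X I"
    and law: "\<And>i. i \<in> I \<Longrightarrow> distr M borel (X i) = N i"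
    and g: "g \<in> borel_measurable (\<Pi>\<^sub>M i\<in>I. borel)"
    and local: "\<And>v. g (restrict v I) = g v"
  shows "(\<integral>\<omega>. g (\<lambda>i. X i \<omega>) \<partial>M) = (\<integral>v. g v \<partial>(\<Pi>\<^sub>M i\<in>I. N i))"
proof -
  have rv: "random_variable borel (X i)" if "i \<in> I" for i
    using indep that by (auto simp: indep_vars_def)
  have "(\<Pi>\<^sub>M i\<in>I. N i) = (\<Pi>\<^sub>M i\<in>I. distr M borel (X i))"
    by (rule PiM_cong) (simp_all add: law)
  also have "\<dots> = distr M (\<Pi>\<^sub>M i\<in>I. borel) (\<lambda>\<omega>. \<lambda>i\<in>I. X i \<omega>)"
    using indep by (subst (asm) indep_vars_iff_distr_eq_PiM'[OF I rv]) auto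
  finally have eq: "(\<Pi>\<^sub>M i\<in>I. N i) = distr M (\<Pi>\<^sub>M i\<in>I. borel) (\<lambda>\<omega>. \<lambda>i\<in>I. X i \<omega>)" .
  have "(\<integral>v. g v \<partial>(\<Pi>\<^sub>M i\<in>I. N i)) = (\<integral>\<omega>. g (\<lambda>i\<in>I. X i \<omega>) \<partial>M)"
    unfolding eq by (rule integral_distr) (use rv g in \<open>auto intro!: measurable_restrict\<close>)
  also have "\<dots> = (\<integral>\<omega>. g (\<lambda>i. X i \<omega>) \<partial>M)"
    using local by simp
  finally show ?thesis by simp
qed

end

locale gaussian_bag = prob_space M for M :: "'a measure" +
  fixes n :: nat and q :: "real ^ 'd" and y :: "nat \<Rightarrow> 'a \<Rightarrow> real ^ 'd"
  assumes n: "n \<ge> 2"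
    and q: "norm q = 1"
    and indep: "indep_vars (\<lambda>_. borel) y {1..n}"
    and law: "\<And>j. j \<in> {1..n} \<Longrightarrow> distr M borel (y j) = std_gaussian"
begin

definition best :: "'a \<Rightarrow> nat" where
  "best \<omega> = arg_max_on (\<lambda>j. y j \<omega> \<bullet> q) {1..n}"

lemma y_measurable: "j \<in> {1..n} \<Longrightarrow> y j \<in> borel_measurable M"
  using indep by (auto simp: indep_vars_def)

lemma best_in: "best \<omega> \<in> {1..n}"
  unfolding best_def using n by (intro arg_max_on_in) auto

lemma law_inner:
  assumes "j \<in> {1..n}" and "norm u = 1"
  shows "distr M borel (\<lambda>\<omega>. y j \<omega> \<bullet> u) = std_normal"
proof -
  have "distr M borel (\<lambda>\<omega>. y j \<omega> \<bullet> u) = distr (distr M borel (y j)) borel (\<lambda>v. v \<bullet> u)"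
    by (subst distr_distr) (auto simp: comp_def y_measurable[OF assms(1)])
  then show ?thesis
    by (simp add: law[OF assms(1)] distr_std_gaussian_inner[OF assms(2)])
qed

lemma integrable_inner:
  fixes g :: "real \<Rightarrow> real"
  assumes j: "j \<in> {1..n}" and u: "norm u = 1" and g: "integrable std_normal g"
  shows "integrable M (\<lambda>\<omega>. g (y j \<omega> \<bullet> u))"
    and integral_inner: "(\<integral>\<omega>. g (y j \<omega> \<bullet> u) \<partial>M) = (\<integral>z. g z \<partial>std_normal)"
proof -
  note [measurable] = y_measurable[OF j]
  have [measurable]: "g \<in> borel_measurable borel"
    using borel_measurable_integrable[OF g] by simp
  show "integrable M (\<lambda>\<omega>. g (y j \<omega> \<bullet> u))"
    using g unfolding law_inner[OF j u, symmetric] by (subst (asm) integrable_distr_eq) auto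
  show "(\<integral>\<omega>. g (y j \<omega> \<bullet> u) \<partial>M) = (\<integral>z. g z \<partial>std_normal)"
    unfolding law_inner[OF j u, symmetric] by (subst integral_distr) auto
qed

lemma best_measurable [measurable]: "best \<in> measurable M (count_space {1..n})"
  unfolding best_def using n
  by (intro measurable_arg_max_on borel_measurable_inner y_measurable) auto

lemma at_best_measurable:
  fixes h :: "nat \<Rightarrow> 'a \<Rightarrow> real"
  assumes "\<And>j. j \<in> {1..n} \<Longrightarrow> h j \<in> borel_measurable M"
  shows "(\<lambda>\<omega>. h (best \<omega>) \<omega>) \<in> borel_measurable M"
  by (rule measurable_compose_countable'[OF assms best_measurable]) auto

lemma integrable_best_inner:
  assumes u: "norm u = 1"
  shows "integrable M (\<lambda>\<omega>. y (best \<omega>) \<omega> \<bullet> u)"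
proof (rule Bochner_Integration.integrable_bound)
  show "integrable M (\<lambda>\<omega>. \<Sum>j=1..n. \<bar>y j \<omega> \<bullet> u\<bar>)"
    using integrable_inner[OF _ u integrable_std_normal_id] by auto
  show "(\<lambda>\<omega>. y (best \<omega>) \<omega> \<bullet> u) \<in> borel_measurable M"
    by (rule at_best_measurable) (intro borel_measurable_inner y_measurable; simp)
  show "AE \<omega> in M. norm (y (best \<omega>) \<omega> \<bullet> u) \<le> norm (\<Sum>j=1..n. \<bar>y j \<omega> \<bullet> u\<bar>)"
  proof (rule AE_I2)
    fix \<omega>
    have "\<bar>y (best \<omega>) \<omega> \<bullet> u\<bar> \<le> (\<Sum>j=1..n. \<bar>y j \<omega> \<bullet> u\<bar>)"
      using best_in by (intro member_le_sum) auto
    then show "norm (y (best \<omega>) \<omega> \<bullet> u) \<le> norm (\<Sum>j=1..n. \<bar>y j \<omega> \<bullet> u\<bar>)"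
      by simp
  qed
qed

text \<open>
  The score of the best instance is the maximum of \<open>n\<close> independent standard normal variables.
\<close>

lemma mean_best_inner_q: "(\<integral>\<omega>. y (best \<omega>) \<omega> \<bullet> q \<partial>M) = gauss_max_mean n"
proof -
  let ?I = "{1..n}"
  have ne: "?I \<noteq> {}" using n by auto
  have "y (best \<omega>) \<omega> \<bullet> q = (MAX j\<in>?I. y j \<omega> \<bullet> q)" for \<omega>
  proof (rule Max_eqI[symmetric])
    show "y (best \<omega>) \<omega> \<bullet> q \<in> (\<lambda>j. y j \<omega> \<bullet> q) ` ?I"
      using best_in by blast
    show "z \<le> y (best \<omega>) \<omega> \<bullet> q" if "z \<in> (\<lambda>j. y j \<omega> \<bullet> q) ` ?I" for z
      using that le_arg_max_on[of ?I _ "\<lambda>j. y j \<omega> \<bullet> q"] ne by (auto simp: best_def)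
  qed simp
  then have "(\<integral>\<omega>. y (best \<omega>) \<omega> \<bullet> q \<partial>M) = (\<integral>\<omega>. (MAX j\<in>?I. y j \<omega> \<bullet> q) \<partial>M)"
    by simp
  also have "\<dots> = (\<integral>X. (MAX j\<in>?I. X j) \<partial>(\<Pi>\<^sub>M j\<in>?I. std_normal))"
  proof (rule integral_indep_family[OF ne, where X = "\<lambda>j \<omega>. y j \<omega> \<bullet> q"])
    show "indep_vars (\<lambda>_. borel) (\<lambda>j \<omega>. y j \<omega> \<bullet> q) ?I"
      by (rule indep_vars_compose2[OF indep]) auto
    show "(\<lambda>v :: nat \<Rightarrow> real. MAX j\<in>?I. v j) \<in> borel_measurable (\<Pi>\<^sub>M i\<in>?I. borel)"
      by (rule borel_measurable_Max[where f = "\<lambda>j v. v j"]) auto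
    show "(MAX j\<in>?I. restrict v ?I j) = (MAX j\<in>?I. v j)" for v :: "nat \<Rightarrow> real"
      by (intro arg_cong[where f = Max] image_cong) auto
  qed (use law_inner q in auto)
  finally show ?thesis by (simp add: gauss_max_mean_def)
qed

text \<open>
  The reflection \<open>R v = 2 (v \<bullet> q) q - v\<close> fixes the direction \<open>q\<close> and reverses its orthogonal complement.
  It preserves the law of the bag and every score \<open>y j \<bullet> q\<close>, hence also the index of the best instance.
  So \<open>y best \<bullet> u\<close> and \<open>R (y best) \<bullet> u = 2 (q \<bullet> u) (y best \<bullet> q) - y best \<bullet> u\<close> have the same mean, and
  that mean is \<open>(q \<bullet> u)\<close> times the mean of \<open>y best \<bullet> q\<close>.
\<close>

lemma mean_best_inner:
  assumes u: "norm u = 1"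
  shows "(\<integral>\<omega>. y (best \<omega>) \<omega> \<bullet> u \<partial>M) = gauss_max_mean n * (q \<bullet> u)"
proof -
  let ?I = "{1..n}"
  have ne: "?I \<noteq> {}" using n by auto
  have qq: "q \<bullet> q = 1" using q by (simp add: dot_square_norm)
  define R where "R v = (2 * (v \<bullet> q)) *\<^sub>R q - v" for v
  have R: "orthogonal_transformation R"
    unfolding orthogonal_transformation_def
  proof
    show "linear R"
      by (rule linearI) (simp_all add: R_def algebra_simps)
    show "\<forall>v w. R v \<bullet> R w = v \<bullet> w"
      by (simp add: R_def inner_diff_left inner_diff_right qq inner_commute)
  qed
  have Rq: "R v \<bullet> q = v \<bullet> q" and Ru: "R v \<bullet> w = 2 * (q \<bullet> w) * (v \<bullet> q) - v \<bullet> w" for v w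
    by (simp_all add: R_def algebra_simps qq)
  note [measurable] = borel_measurable_orthogonal[OF R]
  define h where "h v = v (arg_max_on (\<lambda>j. v j \<bullet> q) ?I) \<bullet> u" for v :: "nat \<Rightarrow> real ^ 'd"
  have h_meas: "h \<in> borel_measurable (\<Pi>\<^sub>M j\<in>?I. borel)"
    unfolding h_def
    by (rule borel_measurable_at_arg_max_on[where c = "\<lambda>j v. v j \<bullet> q" and h = "\<lambda>j v. v j \<bullet> u"])
       (use ne in auto)
  have h_local: "h (restrict v ?I) = h v" for v
  proof -
    have eq: "arg_max_on (\<lambda>j. restrict v ?I j \<bullet> q) ?I = arg_max_on (\<lambda>j. v j \<bullet> q) ?I"
      by (rule arg_max_on_cong) simp
    have "arg_max_on (\<lambda>j. v j \<bullet> q) ?I \<in> ?I" using ne by (intro arg_max_on_in) auto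
    then show ?thesis unfolding h_def eq by simp
  qed
  have reflected: "indep_vars (\<lambda>_. borel) (\<lambda>j \<omega>. R (y j \<omega>)) ?I"
    by (rule indep_vars_compose2[OF indep]) auto
  have law_reflected: "distr M borel (\<lambda>\<omega>. R (y j \<omega>)) = std_gaussian" if "j \<in> ?I" for j
  proof -
    have "distr M borel (\<lambda>\<omega>. R (y j \<omega>)) = distr (distr M borel (y j)) borel R"
      by (subst distr_distr) (auto simp: comp_def y_measurable[OF that])
    then show ?thesis by (simp add: law[OF that] distr_std_gaussian_orthogonal[OF R])
  qed
  have "(\<integral>\<omega>. y (best \<omega>) \<omega> \<bullet> u \<partial>M) = (\<integral>\<omega>. h (\<lambda>j. y j \<omega>) \<partial>M)"
    by (simp add: h_def best_def)
  also have "\<dots> = (\<integral>v. h v \<partial>(\<Pi>\<^sub>M j\<in>?I. std_gaussian))"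
    by (rule integral_indep_family[OF ne indep law h_meas h_local])
  also have "\<dots> = (\<integral>\<omega>. h (\<lambda>j. R (y j \<omega>)) \<partial>M)"
    by (rule integral_indep_family[OF ne reflected law_reflected h_meas h_local, symmetric])
  also have "\<dots> = (\<integral>\<omega>. 2 * (q \<bullet> u) * (y (best \<omega>) \<omega> \<bullet> q) - y (best \<omega>) \<omega> \<bullet> u \<partial>M)"
    unfolding h_def Rq unfolding Ru best_def ..
  also have "\<dots> = 2 * (q \<bullet> u) * gauss_max_mean n - (\<integral>\<omega>. y (best \<omega>) \<omega> \<bullet> u \<partial>M)"
    using integrable_best_inner[OF u] integrable_best_inner[OF q] mean_best_inner_q by simp
  finally show ?thesis by simp
qed

end

section \<open>The exponential moment of a noisily labelled instance\<close>

lemma exp_le_quadratic: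
  fixes u :: real
  shows "exp u \<le> 1 + u + u\<^sup>2 * exp \<bar>u\<bar>"
proof -
  obtain t where t: "\<bar>t\<bar> \<le> \<bar>u\<bar>" and "exp u = (\<Sum>i<2. u ^ i / fact i) + exp t / fact 2 * u ^ 2"
    using Maclaurin_exp_le[of u 2] by blast
  then have "exp u = 1 + u + exp t / 2 * u\<^sup>2"
    by (simp add: numeral_2_eq_2)
  moreover have "exp t / 2 \<le> exp \<bar>u\<bar>"
  proof -
    have "exp t \<le> exp \<bar>u\<bar>" using t by simp
    moreover have "0 < exp t" by simp
    ultimately show ?thesis by linarith
  qed
  then have "exp t / 2 * u\<^sup>2 \<le> exp \<bar>u\<bar> * u\<^sup>2"
    by (rule mult_right_mono) simp
  ultimately show ?thesis by (simp add: mult.commute)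
qed

text \<open>
  Bounds the second-order term in the expansion of the exponential moment below.
\<close>

definition deviation_moment :: "real \<Rightarrow> real" where
  "deviation_moment l = (\<integral>z. (z - l)\<^sup>2 * exp \<bar>z - l\<bar> \<partial>std_normal)"

lemma deviation_moment_nonneg: "0 \<le> deviation_moment l"
  unfolding deviation_moment_def by (rule integral_nonneg_AE) simp

lemma integrable_deviation_moment:
  "integrable std_normal (\<lambda>z. (z - l)\<^sup>2 * exp \<bar>z - l\<bar>)"
proof (rule Bochner_Integration.integrable_bound)
  show "integrable std_normal (\<lambda>z. 2 * exp (- (2 * l)) * exp (2 * z) + 2 * exp (2 * l) * exp ((- 2) * z))"
    by (intro Bochner_Integration.integrable_add integrable_mult_right integrable_std_normal_exp)
  have "(z - l)\<^sup>2 * exp \<bar>z - l\<bar> \<le> 2 * exp (- (2 * l)) * exp (2 * z) + 2 * exp (2 * l) * exp ((- 2) * z)" for z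
  proof -
    let ?u = "\<bar>z - l\<bar>"
    \<comment> \<open>The polynomial factor is absorbed into a second exponential, which has a Gaussian integral.\<close>
    have "?u\<^sup>2 \<le> 2 * exp ?u"
      using exp_lower_Taylor_quadratic[of ?u] by simp
    then have "(z - l)\<^sup>2 * exp ?u \<le> 2 * exp ?u * exp ?u"
      by (intro mult_right_mono) auto
    also have "\<dots> = 2 * exp (2 * ?u)"
      by (simp flip: exp_add)
    also have "\<dots> \<le> 2 * (exp (2 * (z - l)) + exp (2 * (l - z)))"
      by (auto simp: abs_if)
    also have "\<dots> = 2 * exp (- (2 * l)) * exp (2 * z) + 2 * exp (2 * l) * exp ((- 2) * z)"
      by (simp add: algebra_simps flip: exp_add)
    finally show ?thesis .
  qed
  then show "AE z in std_normal. norm ((z - l)\<^sup>2 * exp \<bar>z - l\<bar>)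
      \<le> norm (2 * exp (- (2 * l)) * exp (2 * z) + 2 * exp (2 * l) * exp ((- 2) * z))"
    by (intro AE_I2) (auto intro: order_trans[OF _ abs_ge_self])
qed measurable

context gaussian_bag
begin

lemma mean_weighted_inner:
  assumes u: "norm u = 1"
  shows "(\<integral>\<omega>. (\<Sum>j=1..n. label_weight f n (best \<omega>) j * (y j \<omega> \<bullet> u)) \<partial>M) =
    (f * real n - 1) / (real n - 1) * gauss_max_mean n * (q \<bullet> u)"
    and integrable_weighted_inner:
      "integrable M (\<lambda>\<omega>. \<Sum>j=1..n. label_weight f n (best \<omega>) j * (y j \<omega> \<bullet> u))"
proof -
  have eq: "(\<Sum>j=1..n. label_weight f n (best \<omega>) j * (y j \<omega> \<bullet> u)) =
      (f * real n - 1) / (real n - 1) * (y (best \<omega>) \<omega> \<bullet> u) +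
      (1 - f) / (real n - 1) * (\<Sum>j=1..n. y j \<omega> \<bullet> u)" for \<omega>
    by (rule sum_label_weight[OF n best_in])
  have int_y: "integrable M (\<lambda>\<omega>. y j \<omega> \<bullet> u)" and mean_y: "(\<integral>\<omega>. y j \<omega> \<bullet> u \<partial>M) = 0"
    if "j \<in> {1..n}" for j
    using integrable_inner[OF that u integrable_std_normal_id]
      integral_inner[OF that u integrable_std_normal_id]
    by (simp_all add: integral_std_normal_id)
  have int_sum: "integrable M (\<lambda>\<omega>. \<Sum>j=1..n. y j \<omega> \<bullet> u)"
    using int_y by (intro Bochner_Integration.integrable_sum) auto
  have mean_sum: "(\<integral>\<omega>. (\<Sum>j=1..n. y j \<omega> \<bullet> u) \<partial>M) = 0"
    using int_y mean_y by (subst Bochner_Integration.integral_sum) auto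
  show "integrable M (\<lambda>\<omega>. \<Sum>j=1..n. label_weight f n (best \<omega>) j * (y j \<omega> \<bullet> u))"
    unfolding eq by (intro Bochner_Integration.integrable_add integrable_mult_right integrable_best_inner[OF u] int_sum)
  show "(\<integral>\<omega>. (\<Sum>j=1..n. label_weight f n (best \<omega>) j * (y j \<omega> \<bullet> u)) \<partial>M) =
    (f * real n - 1) / (real n - 1) * gauss_max_mean n * (q \<bullet> u)"
    unfolding eq
    by (subst Bochner_Integration.integral_add)
       (use integrable_best_inner[OF u] int_sum in
         \<open>simp_all add: mean_best_inner[OF u] mean_sum del: One_nat_def\<close>)
qed

text \<open>
  With \<open>l\<close> equal to the mean of a noisily labelled instance in direction \<open>u\<close>, the first-order term of the
  exponential vanishes in expectation.  The exponential moment is therefore \<open>1 + O(t\<^sup>2)\<close>, with a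
  constant that depends on the law of the bag only.
\<close>

lemma weighted_exp_moment:
  fixes l t :: real
  assumes u: "norm u = 1" and f: "f \<in> {0..1}" and t: "\<bar>t\<bar> \<le> 1"
    and l: "l = (f * real n - 1) / (real n - 1) * gauss_max_mean n * (q \<bullet> u)"
  defines "h \<omega> \<equiv> \<Sum>j=1..n. label_weight f n (best \<omega>) j * exp (t * (y j \<omega> \<bullet> u - l))"
  shows "integrable M h" and "(\<integral>\<omega>. h \<omega> \<partial>M) \<le> exp (real n * deviation_moment l * t\<^sup>2)"
proof -
  let ?w = "\<lambda>\<omega> j. label_weight f n (best \<omega>) j"
  let ?z = "\<lambda>\<omega> j. y j \<omega> \<bullet> u - l"
  define r where "r \<omega> = (\<Sum>j=1..n. (?z \<omega> j)\<^sup>2 * exp \<bar>?z \<omega> j\<bar>)" for \<omega>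
  define g where "g \<omega> = 1 + t * ((\<Sum>j=1..n. ?w \<omega> j * (y j \<omega> \<bullet> u)) - l) + t\<^sup>2 * r \<omega>" for \<omega>
  have w0: "0 \<le> ?w \<omega> j" for \<omega> j
    by (rule label_weight_nonneg[OF f n])
  have w1: "?w \<omega> j \<le> 1" for \<omega> j
    using f n by (auto simp: label_weight_def)
  have w_sum: "(\<Sum>j=1..n. ?w \<omega> j) = 1" for \<omega>
  proof -
    have "(\<Sum>j=1..n. ?w \<omega> j) = ((f * real n - 1) + (1 - f) * real n) / (real n - 1)"
      using sum_label_weight[OF n best_in, of f \<omega> "\<lambda>_. 1"] by (simp add: add_divide_distrib)
    also have "(f * real n - 1) + (1 - f) * real n = real n - 1"
      by (simp add: algebra_simps)
    finally show ?thesis using n by simp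
  qed
  have r_int: "integrable M r" and r_mean: "(\<integral>\<omega>. r \<omega> \<partial>M) = real n * deviation_moment l"
  proof -
    have int: "integrable M (\<lambda>\<omega>. (?z \<omega> j)\<^sup>2 * exp \<bar>?z \<omega> j\<bar>)"
      and mean: "(\<integral>\<omega>. (?z \<omega> j)\<^sup>2 * exp \<bar>?z \<omega> j\<bar> \<partial>M) = deviation_moment l" if "j \<in> {1..n}" for j
      using integrable_inner[OF that u integrable_deviation_moment[of l]]
        integral_inner[OF that u integrable_deviation_moment[of l]]
      by (simp_all add: deviation_moment_def)
    show "integrable M r" unfolding r_def using int by (intro Bochner_Integration.integrable_sum) auto
    show "(\<integral>\<omega>. r \<omega> \<partial>M) = real n * deviation_moment l"
      unfolding r_def using int mean by (subst Bochner_Integration.integral_sum) auto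
  qed
  have g_int: "integrable M g"
    unfolding g_def using integrable_weighted_inner[OF u] r_int by simp
  have g_mean: "(\<integral>\<omega>. g \<omega> \<partial>M) = 1 + real n * deviation_moment l * t\<^sup>2"
    unfolding g_def using integrable_weighted_inner[OF u] r_int
    by (simp add: mean_weighted_inner[OF u] r_mean prob_space l del: One_nat_def)
  have h_le: "h \<omega> \<le> g \<omega>" for \<omega>
  proof -
    have summand: "w * exp (t * z) \<le> w + t * (w * z) + t\<^sup>2 * (z\<^sup>2 * exp \<bar>z\<bar>)"
      if w: "0 \<le> w" "w \<le> 1" for w z :: real
    proof -
      have "exp (t * z) \<le> 1 + t * z + (t * z)\<^sup>2 * exp \<bar>t * z\<bar>"
        by (rule exp_le_quadratic)
      also have "\<dots> \<le> 1 + t * z + (t * z)\<^sup>2 * exp \<bar>z\<bar>"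
        using mult_right_mono[OF t, of "\<bar>z\<bar>"]
        by (intro add_left_mono mult_left_mono) (auto simp: abs_mult)
      finally have "w * exp (t * z) \<le> w * (1 + t * z) + w * ((t * z)\<^sup>2 * exp \<bar>z\<bar>)"
        using w by (simp add: mult_left_mono flip: distrib_left)
      moreover have "w * ((t * z)\<^sup>2 * exp \<bar>z\<bar>) \<le> 1 * ((t * z)\<^sup>2 * exp \<bar>z\<bar>)"
        by (rule mult_right_mono[OF w(2)]) simp
      ultimately have "w * exp (t * z) \<le> w * (1 + t * z) + (t * z)\<^sup>2 * exp \<bar>z\<bar>"
        by linarith
      then show ?thesis by (simp add: algebra_simps power_mult_distrib)
    qed
    have "h \<omega> \<le> (\<Sum>j=1..n. ?w \<omega> j + t * (?w \<omega> j * ?z \<omega> j) +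
        t\<^sup>2 * ((?z \<omega> j)\<^sup>2 * exp \<bar>?z \<omega> j\<bar>))"
      unfolding h_def by (intro sum_mono summand w0 w1)
    also have "\<dots> = 1 + t * (\<Sum>j=1..n. ?w \<omega> j * ?z \<omega> j) + t\<^sup>2 * r \<omega>"
      by (simp only: sum.distrib w_sum r_def sum_distrib_left)
    also have "(\<Sum>j=1..n. ?w \<omega> j * ?z \<omega> j) = (\<Sum>j=1..n. ?w \<omega> j * (y j \<omega> \<bullet> u)) - l"
      by (simp only: right_diff_distrib sum_subtractf w_sum mult_1 flip: sum_distrib_right)
    finally show ?thesis by (simp only: g_def)
  qed
  have h_nonneg: "0 \<le> h \<omega>" for \<omega>
    unfolding h_def by (intro sum_nonneg mult_nonneg_nonneg w0) simp
  have h_meas: "h \<in> borel_measurable M"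
  proof -
    note [measurable] = y_measurable
    have "(\<lambda>\<omega>. (\<lambda>i \<omega>. \<Sum>j=1..n. label_weight f n i j * exp (t * ?z \<omega> j)) (best \<omega>) \<omega>)
        \<in> borel_measurable M"
      by (rule at_best_measurable) measurable
    then show ?thesis by (simp add: h_def[abs_def])
  qed
  show "integrable M h"
    by (rule Bochner_Integration.integrable_bound[OF g_int h_meas])
       (use h_le h_nonneg in \<open>auto intro!: AE_I2 intro: order_trans[OF _ abs_ge_self]\<close>)
  then have "(\<integral>\<omega>. h \<omega> \<partial>M) \<le> (\<integral>\<omega>. g \<omega> \<partial>M)"
    using g_int h_le by (intro integral_mono) auto
  also have "\<dots> \<le> exp (real n * deviation_moment l * t\<^sup>2)"
    unfolding g_mean by (rule exp_ge_add_one_self)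
  finally show "(\<integral>\<omega>. h \<omega> \<partial>M) \<le> exp (real n * deviation_moment l * t\<^sup>2)" .
qed

end

section \<open>Conditioning on the instances\<close>

text \<open>
  For an event \<open>G\<close> known to \<open>F\<close>, the probability of \<open>{X = a} \<inter> G\<close> is the integral over \<open>G\<close> of the
  conditional probability of \<open>a\<close>.  It is stated as a bound by an integrable majorant \<open>g\<close>, because the
  conditional probability is an explicit function only up to a null set and that function need not
  be measurable.
\<close>

lemma prob_cond_uniform_le:
  fixes g :: "'a \<Rightarrow> real"
  assumes "prob_space M" and sub: "subalgebra M F" and X: "cond_uniform M F T S X"
    and a: "a \<in> T" and G: "G \<in> sets F"
    and g: "integrable M g"
    and le: "\<And>\<omega>. \<omega> \<in> space M \<Longrightarrow>
      indicator G \<omega> * measure_pmf.prob (pmf_of_set (S \<omega>)) {a} \<le> g \<omega>"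
  shows "{\<omega> \<in> space M. X \<omega> = a} \<inter> G \<in> sets M"
    and "measure M ({\<omega> \<in> space M. X \<omega> = a} \<inter> G) \<le> (\<integral>\<omega>. g \<omega> \<partial>M)"
proof -
  interpret prob_space M by fact
  interpret finite_measure_subalgebra M F
    by unfold_locales (rule sub)
  let ?A = "X -` {a} \<inter> space M"
  have X_meas: "X \<in> measurable M (count_space T)"
    and cond: "AE \<omega> in M. real_cond_exp M F (indicator ?A) \<omega> =
      measure_pmf.prob (pmf_of_set (S \<omega>)) {a}"
    using X a by (auto simp: cond_uniform_def)
  have A [measurable]: "?A \<in> sets M"
    using a by (intro measurable_sets[OF X_meas]) auto
  have GM [measurable]: "G \<in> sets M"
    using sub G by (auto simp: subalgebra_def)
  have eq: "{\<omega> \<in> space M. X \<omega> = a} \<inter> G = ?A \<inter> G" by auto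
  show "{\<omega> \<in> space M. X \<omega> = a} \<inter> G \<in> sets M"
    unfolding eq by measurable
  have product: "indicator G \<omega> * indicator ?A \<omega> = (indicator (?A \<inter> G) \<omega> :: real)" for \<omega>
    by (auto simp: indicator_def)
  have int: "integrable M (\<lambda>\<omega>. indicator G \<omega> * (indicator ?A \<omega> :: real))"
    unfolding product by (rule integrable_real_indicator) (auto simp: less_top[symmetric])
  have G_ind: "(indicator G :: 'a \<Rightarrow> real) \<in> borel_measurable F"
    using G by simp
  have "measure M (?A \<inter> G) = (\<integral>\<omega>. indicator G \<omega> * indicator ?A \<omega> \<partial>M)"
    unfolding product by simp
  also have "\<dots> = (\<integral>\<omega>. indicator G \<omega> * real_cond_exp M F (indicator ?A) \<omega> \<partial>M)"
    by (rule real_cond_exp_intg(2)[OF int G_ind, symmetric]) measurable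
  also have "\<dots> \<le> (\<integral>\<omega>. g \<omega> \<partial>M)"
  proof (rule integral_mono_AE[OF _ g])
    show "integrable M (\<lambda>\<omega>. indicator G \<omega> * real_cond_exp M F (indicator ?A) \<omega>)"
      by (rule real_cond_exp_intg(1)[OF int G_ind]) measurable
    show "AE \<omega> in M. indicator G \<omega> * real_cond_exp M F (indicator ?A) \<omega> \<le> g \<omega>"
      using cond AE_space by eventually_elim (use le in simp)
  qed
  finally show "measure M ({\<omega> \<in> space M. X \<omega> = a} \<inter> G) \<le> (\<integral>\<omega>. g \<omega> \<partial>M)"
    unfolding eq .
qed

section \<open>Deviations of the mean over many bags\<close>

locale gaussian_bags = prob_space M for M :: "'a measure" +
  fixes n :: nat and q :: "real ^ 'd" and x :: "nat \<Rightarrow> nat \<Rightarrow> 'a \<Rightarrow> real ^ 'd"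
  assumes n: "n \<ge> 2"
    and q: "norm q = 1"
    and indep: "indep_vars (\<lambda>_. borel) (\<lambda>(k, j). x k j) ({1..} \<times> {1..n})"
    and law: "\<And>k j. k \<ge> 1 \<Longrightarrow> j \<in> {1..n} \<Longrightarrow> distr M borel (x k j) = std_gaussian"
begin

definition best :: "nat \<Rightarrow> 'a \<Rightarrow> nat" where
  "best k \<omega> = arg_max_on (\<lambda>j. x k j \<omega> \<bullet> q) {1..n}"

lemma x_measurable: "k \<ge> 1 \<Longrightarrow> j \<in> {1..n} \<Longrightarrow> x k j \<in> borel_measurable M"
  using indep by (auto simp: indep_vars_def)

lemma best_in: "best k \<omega> \<in> {1..n}"
  unfolding best_def using n by (intro arg_max_on_in) auto

lemma gaussian_bag:
  assumes "k \<ge> 1"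
  shows "gaussian_bag M n q (x k)"
proof unfold_locales
  let ?X = "\<lambda>i. case i of (k, j) \<Rightarrow> x k j"
  have "indep_vars (\<lambda>j. \<Pi>\<^sub>M i\<in>{(k, j)}. borel) (\<lambda>j \<omega>. restrict (\<lambda>i. ?X i \<omega>) {(k, j)}) {1..n}"
    by (rule indep_vars_restrict[OF indep]) (use assms in \<open>auto simp: disjoint_family_on_def\<close>)
  then have "indep_vars (\<lambda>_. borel) (\<lambda>j \<omega>. restrict (\<lambda>i. ?X i \<omega>) {(k, j)} (k, j)) {1..n}"
    by (rule indep_vars_compose2[where Y = "\<lambda>j g. g (k, j)"]) simp
  then show "indep_vars (\<lambda>_. borel) (x k) {1..n}"
    by simp
qed (use n q law assms in auto)

text \<open>
  The component of the limit vector in direction \<open>u\<close>.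
\<close>

definition signal :: "real \<Rightarrow> real ^ 'd \<Rightarrow> real" where
  "signal f u = (f * real n - 1) / (real n - 1) * gauss_max_mean n * (q \<bullet> u)"

text \<open>
  The contribution of label \<open>j\<close> of bag \<open>k\<close> to the exponential moment at \<open>t\<close> of the centred instance, when
  the label is drawn from \<^const>\<open>label_weight\<close>.
\<close>

definition tilt :: "real \<Rightarrow> real ^ 'd \<Rightarrow> real \<Rightarrow> nat \<Rightarrow> 'a \<Rightarrow> nat \<Rightarrow> real" where
  "tilt f u t k \<omega> j =
    label_weight f n (best k \<omega>) j * exp (t * (x k j \<omega> \<bullet> u - signal f u))"

lemma tilt_moment:
  assumes u: "norm u = 1" and f: "f \<in> {0..1}" and t: "\<bar>t\<bar> \<le> 1" and k: "k \<ge> 1"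
  shows "integrable M (\<lambda>\<omega>. \<Sum>j=1..n. tilt f u t k \<omega> j)"
    and "(\<integral>\<omega>. (\<Sum>j=1..n. tilt f u t k \<omega> j) \<partial>M) \<le>
      exp (real n * deviation_moment (signal f u) * t\<^sup>2)"
proof -
  interpret bag: gaussian_bag M n q "x k"
    by (rule gaussian_bag[OF k])
  have "best k \<omega> = bag.best \<omega>" for \<omega>
    by (simp add: best_def bag.best_def)
  then show "integrable M (\<lambda>\<omega>. \<Sum>j=1..n. tilt f u t k \<omega> j)"
    and "(\<integral>\<omega>. (\<Sum>j=1..n. tilt f u t k \<omega> j) \<partial>M) \<le>
      exp (real n * deviation_moment (signal f u) * t\<^sup>2)"
    using bag.weighted_exp_moment[OF u f t, of "signal f u"]
    by (simp_all only: tilt_def signal_def)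
qed

text \<open>
  The contribution of bag \<open>k\<close> is a measurable function of the instances in row \<open>k\<close>, and distinct
  rows are disjoint.
\<close>

lemma indep_vars_tilt:
  "indep_vars (\<lambda>_. borel) (\<lambda>k \<omega>. \<Sum>j=1..n. tilt f u t k \<omega> j) {1..m}"
proof -
  let ?K = "\<lambda>k :: nat. {k} \<times> {1..n}"
  define top where "top k g = arg_max_on (\<lambda>j. g (k, j) \<bullet> q) {1..n}"
    for k and g :: "nat \<times> nat \<Rightarrow> real ^ 'd"
  define h where "h k g =
    (\<Sum>j=1..n. label_weight f n (top k g) j * exp (t * (g (k, j) \<bullet> u - signal f u)))"
    for k and g :: "nat \<times> nat \<Rightarrow> real ^ 'd"
  have "indep_vars (\<lambda>k. \<Pi>\<^sub>M i\<in>?K k. borel)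
      (\<lambda>k \<omega>. restrict (\<lambda>i. (case i of (k, j) \<Rightarrow> x k j) \<omega>) (?K k)) {1..m}"
    by (rule indep_vars_restrict[OF indep]) (auto simp: disjoint_family_on_def)
  then have "indep_vars (\<lambda>_. borel)
      (\<lambda>k \<omega>. h k (restrict (\<lambda>i. (case i of (k, j) \<Rightarrow> x k j) \<omega>) (?K k))) {1..m}"
  proof (rule indep_vars_compose2)
    fix k :: nat
    have comp: "(\<lambda>g. g (k, j)) \<in> borel_measurable (\<Pi>\<^sub>M i\<in>?K k. (borel :: (real ^ 'd) measure))"
      if "j \<in> {1..n}" for j
      using that by (intro measurable_component_singleton) auto
    note [measurable] = comp
    have top_meas: "top k \<in> measurable (\<Pi>\<^sub>M i\<in>?K k. borel) (count_space {1..n})"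
      unfolding top_def using n
      by (intro measurable_arg_max_on borel_measurable_inner comp) auto
    have "(\<lambda>g. (\<lambda>i g. \<Sum>j=1..n. label_weight f n i j * exp (t * (g (k, j) \<bullet> u - signal f u)))
        (top k g) g) \<in> borel_measurable (\<Pi>\<^sub>M i\<in>?K k. borel)"
      by (rule measurable_compose_countable'[OF _ top_meas]) auto
    then show "h k \<in> borel_measurable (\<Pi>\<^sub>M i\<in>?K k. borel)"
      by (simp add: h_def[abs_def])
  qed
  moreover have "h k (restrict (\<lambda>i. (case i of (k, j) \<Rightarrow> x k j) \<omega>) (?K k)) =
      (\<Sum>j=1..n. tilt f u t k \<omega> j)" for k \<omega>
  proof -
    have "top k (restrict (\<lambda>i. (case i of (k, j) \<Rightarrow> x k j) \<omega>) (?K k)) = best k \<omega>"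
      unfolding top_def best_def by (rule arg_max_on_cong) simp
    then show ?thesis by (simp add: h_def tilt_def)
  qed
  ultimately show ?thesis by simp
qed

text \<open>
  For a product law on assignments the sum over all assignments is a product over the bags, and the
  bags are independent.  So the exponential moment of the total is the product of those of the bags.
\<close>

lemma tilt_product_moment:
  assumes u: "norm u = 1" and f: "f \<in> {0..1}" and t: "\<bar>t\<bar> \<le> 1"
  shows "integrable M (\<lambda>\<omega>. \<Sum>a\<in>assignments m n. \<Prod>k=1..m. tilt f u t k \<omega> (a k))"
    and "(\<integral>\<omega>. (\<Sum>a\<in>assignments m n. \<Prod>k=1..m. tilt f u t k \<omega> (a k)) \<partial>M) \<le>
      exp (real m * (real n * deviation_moment (signal f u) * t\<^sup>2))"
proof -
  let ?h = "\<lambda>k \<omega>. \<Sum>j=1..n. tilt f u t k \<omega> j"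
  have expand: "(\<Sum>a\<in>assignments m n. \<Prod>k=1..m. tilt f u t k \<omega> (a k)) = (\<Prod>k=1..m. ?h k \<omega>)" for \<omega>
    unfolding assignments_def by (rule prod_sum_PiE[symmetric]) auto
  have int: "integrable M (?h k)" if "k \<in> {1..m}" for k
    using tilt_moment(1)[OF u f t] that by simp
  show "integrable M (\<lambda>\<omega>. \<Sum>a\<in>assignments m n. \<Prod>k=1..m. tilt f u t k \<omega> (a k))"
    unfolding expand by (rule indep_vars_integrable[OF _ indep_vars_tilt int]) auto
  have "(\<integral>\<omega>. (\<Prod>k=1..m. ?h k \<omega>) \<partial>M) = (\<Prod>k=1..m. \<integral>\<omega>. ?h k \<omega> \<partial>M)"
    by (rule indep_vars_lebesgue_integral[OF _ indep_vars_tilt int]) auto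
  also have "\<dots> \<le> (\<Prod>k=1..m. exp (real n * deviation_moment (signal f u) * t\<^sup>2))"
  proof (rule prod_mono, intro conjI)
    fix k assume k: "k \<in> {1..m}"
    then show "(\<integral>\<omega>. ?h k \<omega> \<partial>M) \<le> exp (real n * deviation_moment (signal f u) * t\<^sup>2)"
      using tilt_moment(2)[OF u f t] by simp
    show "0 \<le> (\<integral>\<omega>. ?h k \<omega> \<partial>M)"
      by (intro integral_nonneg_AE AE_I2 sum_nonneg)
         (simp add: tilt_def label_weight_nonneg[OF f n])
  qed
  also have "\<dots> = exp (real m * (real n * deviation_moment (signal f u) * t\<^sup>2))"
    by (simp add: exp_of_nat_mult[symmetric])
  finally show "(\<integral>\<omega>. (\<Sum>a\<in>assignments m n. \<Prod>k=1..m. tilt f u t k \<omega> (a k)) \<partial>M) \<le>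
      exp (real m * (real n * deviation_moment (signal f u) * t\<^sup>2))"
    unfolding expand .
qed

lemma tilt_single_integrable:
  assumes u: "norm u = 1" and f: "f \<in> {0..1}" and t: "\<bar>t\<bar> \<le> 1" and a: "a \<in> assignments m n"
  shows "integrable M (\<lambda>\<omega>. \<Prod>k=1..m. tilt f u t k \<omega> (a k))"
proof (rule Bochner_Integration.integrable_bound[OF tilt_product_moment(1)[OF u f t, of m]])
  have a_in: "a k \<in> {1..n}" if "k \<in> {1..m}" for k
    using a that by (auto simp: assignments_def PiE_iff)
  show "(\<lambda>\<omega>. \<Prod>k=1..m. tilt f u t k \<omega> (a k)) \<in> borel_measurable M"
  proof (rule borel_measurable_prod)
    fix k assume k: "k \<in> {1..m}"
    then interpret bag: gaussian_bag M n q "x k"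
      by (intro gaussian_bag) simp
    note [measurable] = bag.y_measurable[OF a_in[OF k]]
    have "(\<lambda>\<omega>. (\<lambda>i \<omega>. label_weight f n i (a k) * exp (t * (x k (a k) \<omega> \<bullet> u - signal f u)))
        (bag.best \<omega>) \<omega>) \<in> borel_measurable M"
      by (rule bag.at_best_measurable) measurable
    then show "(\<lambda>\<omega>. tilt f u t k \<omega> (a k)) \<in> borel_measurable M"
      by (simp add: tilt_def best_def bag.best_def)
  qed
  have nonneg: "0 \<le> (\<Prod>k=1..m. tilt f u t k \<omega> (a k))" for \<omega> and a :: "nat \<Rightarrow> nat"
    by (intro prod_nonneg) (simp add: tilt_def label_weight_nonneg[OF f n])
  have "(\<Prod>k=1..m. tilt f u t k \<omega> (a k)) \<le>
      (\<Sum>a\<in>assignments m n. \<Prod>k=1..m. tilt f u t k \<omega> (a k))" for \<omega>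
    by (rule member_le_sum[OF a]) (auto intro: nonneg finite_assignments simp del: One_nat_def)
  then show "AE \<omega> in M. norm (\<Prod>k=1..m. tilt f u t k \<omega> (a k)) \<le>
      norm (\<Sum>a\<in>assignments m n. \<Prod>k=1..m. tilt f u t k \<omega> (a k))"
    using nonneg by (intro AE_I2) (simp add: sum_nonneg del: One_nat_def)
qed

lemma instance_algebra_component:
  assumes "k \<in> {1..m}" and "j \<in> {1..n}"
  shows "x k j \<in> borel_measurable (instance_algebra M m n x)"
proof -
  have "(\<lambda>\<omega>. \<lambda>(k, j)\<in>{1..m} \<times> {1..n}. x k j \<omega>) \<in>
      measurable (instance_algebra M m n x) (\<Pi>\<^sub>M i\<in>{1..m} \<times> {1..n}. borel)"
    unfolding instance_algebra_def
    by (rule measurable_vimage_algebra1) (auto simp: space_PiM)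
  from measurable_compose[OF this measurable_component_singleton, of "(k, j)"]
  show ?thesis using assms by simp
qed

lemma subalgebra_instance_algebra: "subalgebra M (instance_algebra M m n x)"
proof -
  have "(\<lambda>\<omega>. \<lambda>(k, j)\<in>{1..m} \<times> {1..n}. x k j \<omega>) \<in>
      measurable M (\<Pi>\<^sub>M i\<in>{1..m} \<times> {1..n}. borel)"
  proof (rule measurable_restrict)
    fix i :: "nat \<times> nat" assume "i \<in> {1..m} \<times> {1..n}"
    then show "(\<lambda>\<omega>. case i of (k, j) \<Rightarrow> x k j \<omega>) \<in> borel_measurable M"
      by (cases i) (auto intro!: x_measurable)
  qed
  then show ?thesis
    unfolding subalgebra_def instance_algebra_def
    using sets_image_in_sets[OF refl] by (simp del: One_nat_def)
qed

text \<open>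
  Chernoff's bound.  The deviation event splits according to the value \<open>a\<close> of the random assignment
  into events \<open>G a\<close> that depend on the instances only.  On \<open>G a\<close> the indicator is at most
  \<open>exp (- t m \<epsilon>) * (exp (t dev) + exp (- t dev))\<close>, and the conditional probability of \<open>a\<close> is at most \<open>m + 1\<close>
  times its probability under independent labels.  Summing over \<open>a\<close> yields the product moments at
  \<open>t\<close> and \<open>- t\<close>.
\<close>

lemma deviation_probability_le:
  fixes \<xi> :: "'a \<Rightarrow> nat \<Rightarrow> nat" and \<epsilon> :: real
  assumes u: "norm u = 1" and f: "f \<in> {0..1}" and t: "0 \<le> t" "t \<le> 1"
    and m: "1 \<le> m" and fm: "f * real m \<in> \<int>"
    and \<xi>: "cond_uniform M (instance_algebra M m n x) (assignments m n)
        (\<lambda>\<omega>. accuracy_set m n f (best_assignment m n q (\<lambda>k j. x k j \<omega>))) \<xi>"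
  defines "E \<equiv> {\<omega> \<in> space M.
      \<epsilon> \<le> \<bar>assignment_mean m (\<lambda>k j. x k j \<omega>) (\<xi> \<omega>) \<bullet> u - signal f u\<bar>}"
  shows "E \<in> sets M"
    and "measure M E \<le> 2 * real (m + 1) *
      exp (real m * (real n * deviation_moment (signal f u) * t\<^sup>2 - t * \<epsilon>))"
proof -
  let ?F = "instance_algebra M m n x" and ?A = "assignments m n"
  define dev where "dev a \<omega> = (\<Sum>k=1..m. x k (a k) \<omega> \<bullet> u - signal f u)" for a \<omega>
  define P where "P s a \<omega> = (\<Prod>k=1..m. tilt f u s k \<omega> (a k))" for s a \<omega>
  define c where "c = real (m + 1) * exp (- (t * real m * \<epsilon>))"
  define g where "g a \<omega> = c * (P t a \<omega> + P (- t) a \<omega>)" for a \<omega>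
  define G where "G a = {\<omega> \<in> space M. real m * \<epsilon> \<le> \<bar>dev a \<omega>\<bar>}" for a
  have mpos: "0 < real m" using m by simp
  have mean_dev: "assignment_mean m (\<lambda>k j. x k j \<omega>) a \<bullet> u - signal f u = dev a \<omega> / real m" for a \<omega>
    using mpos by (simp add: assignment_mean_def dev_def sum_subtractf inner_sum_left field_simps)
  have dev_meas: "dev a \<in> borel_measurable ?F" if "a \<in> ?A" for a
    unfolding dev_def using that
    by (intro borel_measurable_sum borel_measurable_diff borel_measurable_inner
        instance_algebra_component) (auto simp: assignments_def PiE_iff)
  have space_F: "space ?F = space M"
    using subalgebra_instance_algebra[of m] by (simp add: subalgebra_def)
  have G_sets: "G a \<in> sets ?F" if "a \<in> ?A" for a
  proof -
    note [measurable] = dev_meas[OF that]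
    have "{\<omega> \<in> space ?F. real m * \<epsilon> \<le> \<bar>dev a \<omega>\<bar>} \<in> sets ?F" by measurable
    then show ?thesis by (simp add: G_def space_F)
  qed
  have g_int: "integrable M (g a)" if "a \<in> ?A" for a
    unfolding g_def P_def using t that
    by (intro integrable_mult_right Bochner_Integration.integrable_add tilt_single_integrable[OF u f]) auto
  have P_eq: "P s a \<omega> = (\<Prod>k=1..m. label_weight f n (best k \<omega>) (a k)) * exp (s * dev a \<omega>)" for s a \<omega>
    unfolding P_def tilt_def dev_def by (simp add: prod.distrib sum_distrib_left exp_sum)
  have weight_nonneg: "0 \<le> (\<Prod>k=1..m. label_weight f n (best k \<omega>) (a k))" for a \<omega>
    by (intro prod_nonneg) (simp add: label_weight_nonneg[OF f n])
  have g_bound: "indicator (G a) \<omega> *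
      measure_pmf.prob (pmf_of_set (accuracy_set m n f (best_assignment m n q (\<lambda>k j. x k j \<omega>)))) {a}
      \<le> g a \<omega>" if a: "a \<in> ?A" for a \<omega>
  proof (cases "\<omega> \<in> G a")
    case False
    have "0 \<le> g a \<omega>"
      unfolding g_def P_eq c_def using weight_nonneg[of \<omega> a]
      by (intro mult_nonneg_nonneg add_nonneg_nonneg) auto
    then show ?thesis using False by simp
  next
    case True
    let ?w = "\<Prod>k=1..m. label_weight f n (best k \<omega>) (a k)"
    have "t * (real m * \<epsilon>) \<le> t * \<bar>dev a \<omega>\<bar>"
      using True t by (intro mult_left_mono) (auto simp: G_def)
    then have "1 \<le> exp (- (t * real m * \<epsilon>)) * exp (t * \<bar>dev a \<omega>\<bar>)"
      by (simp flip: exp_add)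
    also have "\<dots> \<le> exp (- (t * real m * \<epsilon>)) * (exp (t * dev a \<omega>) + exp (- t * dev a \<omega>))"
      by (intro mult_left_mono) (auto simp: abs_if)
    finally have exp_ge: "1 \<le> exp (- (t * real m * \<epsilon>)) * (exp (t * dev a \<omega>) + exp (- t * dev a \<omega>))" .
    have best_pi: "best_assignment m n q (\<lambda>k j. x k j \<omega>) \<in> {1..m} \<rightarrow> {1..n}"
      using best_in by (auto simp: best_assignment_def best_def)
    have "measure_pmf.prob (pmf_of_set (accuracy_set m n f (best_assignment m n q (\<lambda>k j. x k j \<omega>)))) {a}
        \<le> real (m + 1) * (\<Prod>k=1..m. label_weight f n (best_assignment m n q (\<lambda>k j. x k j \<omega>) k) (a k))"
      by (rule uniform_accuracy_le_product[OF m n f fm best_pi a])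
    also have "(\<Prod>k=1..m. label_weight f n (best_assignment m n q (\<lambda>k j. x k j \<omega>) k) (a k)) = ?w"
      by (intro prod.cong) (auto simp: best_assignment_def best_def)
    also have "real (m + 1) * ?w \<le> real (m + 1) * ?w *
        (exp (- (t * real m * \<epsilon>)) * (exp (t * dev a \<omega>) + exp (- t * dev a \<omega>)))"
      using mult_left_mono[OF exp_ge, of "real (m + 1) * ?w"] weight_nonneg[of \<omega> a] by simp
    also have "\<dots> = g a \<omega>"
      unfolding g_def P_eq c_def by (simp only: distrib_left mult_ac)
    finally show ?thesis using True by simp
  qed
  have \<xi>_in: "\<xi> \<omega> \<in> ?A" if "\<omega> \<in> space M" for \<omega>
    using \<xi> that by (auto simp: cond_uniform_def dest: measurable_space)
  have E_eq: "E = (\<Union>a\<in>?A. {\<omega> \<in> space M. \<xi> \<omega> = a} \<inter> G a)"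
    unfolding E_def G_def mean_dev using \<xi>_in mpos by (auto simp: pos_le_divide_eq abs_divide mult.commute)
  note step = prob_cond_uniform_le[OF prob_space_axioms subalgebra_instance_algebra \<xi> _ G_sets g_int g_bound]
  show "E \<in> sets M"
    unfolding E_eq using step(1) finite_assignments by (intro sets.finite_UN) auto
  have "measure M E \<le> (\<Sum>a\<in>?A. measure M ({\<omega> \<in> space M. \<xi> \<omega> = a} \<inter> G a))"
    unfolding E_eq using step(1) finite_assignments by (intro finite_measure_subadditive_finite) auto
  also have "\<dots> \<le> (\<Sum>a\<in>?A. \<integral>\<omega>. g a \<omega> \<partial>M)"
    using step(2) by (intro sum_mono) auto
  also have "\<dots> = (\<integral>\<omega>. (\<Sum>a\<in>?A. g a \<omega>) \<partial>M)"
    using g_int by (intro Bochner_Integration.integral_sum[symmetric]) auto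
  also have "\<dots> = (\<integral>\<omega>. c * ((\<Sum>a\<in>?A. P t a \<omega>) + (\<Sum>a\<in>?A. P (- t) a \<omega>)) \<partial>M)"
    by (simp only: g_def sum.distrib sum_distrib_left distrib_left)
  also have "\<dots> = c * ((\<integral>\<omega>. (\<Sum>a\<in>?A. P t a \<omega>) \<partial>M) + (\<integral>\<omega>. (\<Sum>a\<in>?A. P (- t) a \<omega>) \<partial>M))"
    unfolding P_def using t tilt_product_moment(1)[OF u f, of t m] tilt_product_moment(1)[OF u f, of "- t" m]
    by (simp del: One_nat_def)
  also have "\<dots> \<le> c * (exp (real m * (real n * deviation_moment (signal f u) * t\<^sup>2)) +
      exp (real m * (real n * deviation_moment (signal f u) * t\<^sup>2)))"
    unfolding P_def using t tilt_product_moment(2)[OF u f, of t m] tilt_product_moment(2)[OF u f, of "- t" m]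
    by (intro mult_left_mono add_mono) (auto simp: c_def simp del: One_nat_def)
  also have "\<dots> = 2 * real (m + 1) *
      exp (real m * (real n * deviation_moment (signal f u) * t\<^sup>2 - t * \<epsilon>))"
  proof -
    have "exp (real m * (real n * deviation_moment (signal f u) * t\<^sup>2 - t * \<epsilon>)) =
        exp (- (t * real m * \<epsilon>)) * exp (real m * (real n * deviation_moment (signal f u) * t\<^sup>2))"
      by (simp add: algebra_simps flip: exp_add)
    then show ?thesis by (simp add: c_def)
  qed
  finally show "measure M E \<le> 2 * real (m + 1) *
      exp (real m * (real n * deviation_moment (signal f u) * t\<^sup>2 - t * \<epsilon>))" .
qed

section \<open>Convergence of the mean and of the direction\<close>

text \<open>
  The exponent \<open>D t\<^sup>2 - t \<epsilon>\<close> is negative for small \<open>t > 0\<close>, so the deviation probabilities are summable in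
  \<open>m\<close> despite the factor \<open>m + 1\<close>, and the Borel-Cantelli lemma applies.
\<close>

lemma AE_deviation_small:
  fixes \<xi> :: "nat \<Rightarrow> 'a \<Rightarrow> nat \<Rightarrow> nat"
  assumes u: "norm u = 1" and f: "f \<in> {0..1}" and \<epsilon>: "0 < \<epsilon>"
    and \<xi>: "\<And>m. m \<ge> 1 \<Longrightarrow> f * real m \<in> \<int> \<Longrightarrow>
      cond_uniform M (instance_algebra M m n x) (assignments m n)
        (\<lambda>\<omega>. accuracy_set m n f (best_assignment m n q (\<lambda>k j. x k j \<omega>))) (\<xi> m)"
  shows "AE \<omega> in M. \<forall>\<^sub>F m in admissible_at_top f.
    \<bar>assignment_mean m (\<lambda>k j. x k j \<omega>) (\<xi> m \<omega>) \<bullet> u - signal f u\<bar> < \<epsilon>"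
proof -
  define D where "D = real n * deviation_moment (signal f u)"
  \<comment> \<open>This choice makes the quadratic term at most half of the linear one.\<close>
  define t where "t = min 1 (\<epsilon> / (2 * (D + 1)))"
  define \<rho> where "\<rho> = exp (- (t * \<epsilon> / 2))"
  define E where "E m = {\<omega> \<in> space M.
    \<epsilon> \<le> \<bar>assignment_mean m (\<lambda>k j. x k j \<omega>) (\<xi> m \<omega>) \<bullet> u - signal f u\<bar>}" for m
  define A where "A m = (if 1 \<le> m \<and> f * real m \<in> \<int> then E m else {})" for m
  have D: "0 \<le> D" by (simp add: D_def deviation_moment_nonneg)
  have t: "0 < t" "t \<le> 1" using \<epsilon> D by (auto simp: t_def)
  have "(D + 1) * t \<le> (D + 1) * (\<epsilon> / (2 * (D + 1)))"
    using D by (intro mult_left_mono) (auto simp: t_def)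
  also have "\<dots> = \<epsilon> / 2" using D by (simp add: field_simps)
  finally have "D * t \<le> \<epsilon> / 2" using t by (simp add: algebra_simps)
  then have "t * (D * t) \<le> t * (\<epsilon> / 2)" using t by (intro mult_left_mono) auto
  then have exponent: "D * t\<^sup>2 - t * \<epsilon> \<le> - (t * \<epsilon> / 2)"
    by (simp add: power2_eq_square algebra_simps)
  have A_sets: "A m \<in> sets M" for m
    using deviation_probability_le(1)[OF u f _ t(2) _ _ \<xi>, of m \<epsilon>] t by (auto simp: A_def E_def)
  have A_le: "measure M (A m) \<le> 2 * (real (Suc m) * \<rho> ^ m)" for m
  proof (cases "1 \<le> m \<and> f * real m \<in> \<int>")
    case True
    then have "measure M (A m) \<le> 2 * real (m + 1) * exp (real m * (D * t\<^sup>2 - t * \<epsilon>))"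
      using deviation_probability_le(2)[OF u f _ t(2) _ _ \<xi>, of m \<epsilon>] t
      by (simp add: A_def E_def D_def)
    also have "\<dots> \<le> 2 * real (m + 1) * exp (real m * (- (t * \<epsilon> / 2)))"
      using mult_left_mono[OF exponent, of "real m"] by (intro mult_left_mono) auto
    also have "\<dots> = 2 * (real (Suc m) * \<rho> ^ m)"
      unfolding \<rho>_def by (simp only: exp_of_nat_mult) simp
    finally show ?thesis .
  next
    case False
    then show ?thesis by (auto simp: A_def \<rho>_def)
  qed
  have "norm \<rho> < 1" using t \<epsilon> by (simp add: \<rho>_def)
  then have "summable (\<lambda>m. 2 * (real (Suc m) * \<rho> ^ m))"
    by (intro summable_mult sums_summable[OF geometric_deriv_sums])
  then have "summable (\<lambda>m. measure M (A m))"
    by (rule summable_comparison_test') (use A_le in auto)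
  then have "AE \<omega> in M. \<forall>\<^sub>F m in sequentially. \<omega> \<in> space M - A m"
    by (intro borel_cantelli_AE1 A_sets) (auto simp: emeasure_eq_measure)
  then show ?thesis
    by eventually_elim
       (auto simp: admissible_at_top_def eventually_inf_principal A_def E_def not_le elim!: eventually_mono)
qed

text \<open>
  Convergence is tested on the finitely many coordinates and on a sequence of tolerances, so that only
  countably many exceptional null sets have to be united.
\<close>

lemma AE_assignment_mean_tendsto:
  fixes \<xi> :: "nat \<Rightarrow> 'a \<Rightarrow> nat \<Rightarrow> nat"
  assumes f: "f \<in> {0..1}"
    and \<xi>: "\<And>m. m \<ge> 1 \<Longrightarrow> f * real m \<in> \<int> \<Longrightarrow>
      cond_uniform M (instance_algebra M m n x) (assignments m n)
        (\<lambda>\<omega>. accuracy_set m n f (best_assignment m n q (\<lambda>k j. x k j \<omega>))) (\<xi> m)"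
  shows "AE \<omega> in M. ((\<lambda>m. assignment_mean m (\<lambda>k j. x k j \<omega>) (\<xi> m \<omega>)) \<longlongrightarrow>
    ((f * real n - 1) / (real n - 1) * gauss_max_mean n) *\<^sub>R q) (admissible_at_top f)"
proof -
  have "AE \<omega> in M. \<forall>i p. \<forall>\<^sub>F m in admissible_at_top f.
      \<bar>assignment_mean m (\<lambda>k j. x k j \<omega>) (\<xi> m \<omega>) \<bullet> axis i 1 - signal f (axis i 1)\<bar>
        < inverse (real (Suc p))"
    unfolding AE_all_countable
    by (intro allI AE_deviation_small f \<xi>) auto
  then show ?thesis
  proof eventually_elim
    case (elim \<omega>)
    show ?case
    proof (intro vec_tendstoI tendstoI)
      fix i and e :: real assume "0 < e"
      then obtain p where p: "inverse (real (Suc p)) < e"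
        using reals_Archimedean by blast
      show "\<forall>\<^sub>F m in admissible_at_top f.
        dist (assignment_mean m (\<lambda>k j. x k j \<omega>) (\<xi> m \<omega>) $ i)
          ((((f * real n - 1) / (real n - 1) * gauss_max_mean n) *\<^sub>R q) $ i) < e"
        using elim[rule_format, of i p]
        by eventually_elim (use p in \<open>simp add: dist_real_def inner_axis signal_def\<close>)
    qed
  qed
qed

end

theorem theorem4p8:
  fixes M :: "'a measure"
    and x :: "nat \<Rightarrow> nat \<Rightarrow> 'a \<Rightarrow> real ^ 'd"
    and q :: "real ^ 'd"
    and n :: nat
    and f :: real
    and \<xi> :: "nat \<Rightarrow> 'a \<Rightarrow> nat \<Rightarrow> nat"
  assumes "prob_space M"
    and "n \<ge> 2"
    and "q \<in> sphere 0 1"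
    and "prob_space.indep_vars M (\<lambda>_. borel) (\<lambda>(k, j). x k j) ({1..} \<times> {1..n})"
    and "\<And>k j. k \<ge> 1 \<Longrightarrow> j \<in> {1..n} \<Longrightarrow>
      distributed M lborel (x k j) (\<lambda>v. ennreal (std_gaussian_density v))"
    and "f \<in> {0..1}"
    and "\<And>m. m \<ge> 1 \<Longrightarrow> f * real m \<in> \<int> \<Longrightarrow>
      cond_uniform M (instance_algebra M m n x) (assignments m n)
        (\<lambda>\<omega>. accuracy_set m n f (best_assignment m n q (\<lambda>k j. x k j \<omega>))) (\<xi> m)"
  shows "(AE \<omega> in M.
        ((\<lambda>m. assignment_mean m (\<lambda>k j. x k j \<omega>) (\<xi> m \<omega>)) \<longlongrightarrow>
          ((f * real n - 1) / (real n - 1) * gauss_max_mean n) *\<^sub>R q) (admissible_at_top f)) \<and>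
      (f > 1 / real n \<longrightarrow>
        (f * real n - 1) / (real n - 1) * gauss_max_mean n > 0 \<and>
        (AE \<omega> in M.
          ((\<lambda>m. assignment_direction m (\<lambda>k j. x k j \<omega>) (\<xi> m \<omega>)) \<longlongrightarrow> q)
            (admissible_at_top f)))"
proof -
  interpret prob_space M by fact
  have q: "norm q = 1" using assms(3) by simp
  interpret gaussian_bags M n q x
  proof unfold_locales
    fix k j :: nat assume "k \<ge> 1" "j \<in> {1..n}"
    then have "distr M lborel (x k j) = std_gaussian"
      using assms(5) by (simp add: distributed_def std_gaussian_def)
    moreover have "distr M lborel (x k j) = distr M borel (x k j)"
      by (rule distr_cong) simp_all
    ultimately show "distr M borel (x k j) = std_gaussian" by simp
  qed (use assms q in auto)
  let ?c = "(f * real n - 1) / (real n - 1) * gauss_max_mean n"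
  have mean: "AE \<omega> in M.
      ((\<lambda>m. assignment_mean m (\<lambda>k j. x k j \<omega>) (\<xi> m \<omega>)) \<longlongrightarrow> ?c *\<^sub>R q) (admissible_at_top f)"
    by (rule AE_assignment_mean_tendsto[OF assms(6,7)])
  have direction: "?c > 0 \<and> (AE \<omega> in M.
      ((\<lambda>m. assignment_direction m (\<lambda>k j. x k j \<omega>) (\<xi> m \<omega>)) \<longlongrightarrow> q) (admissible_at_top f))"
    if "f > 1 / real n"
  proof
    have "f * real n > 1" using that \<open>n \<ge> 2\<close> by (simp add: field_simps)
    then show c: "?c > 0"
      using gauss_max_mean_pos[OF \<open>n \<ge> 2\<close>] \<open>n \<ge> 2\<close> by simp
    then have ne: "?c *\<^sub>R q \<noteq> 0" using q by auto
    have normalize: "(c *\<^sub>R q) /\<^sub>R norm (c *\<^sub>R q) = q" if "c > 0" for c :: real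
      using that q by simp
    show "AE \<omega> in M.
      ((\<lambda>m. assignment_direction m (\<lambda>k j. x k j \<omega>) (\<xi> m \<omega>)) \<longlongrightarrow> q) (admissible_at_top f)"
      using mean
    proof eventually_elim
      case (elim \<omega>)
      have "((\<lambda>m. assignment_direction m (\<lambda>k j. x k j \<omega>) (\<xi> m \<omega>)) \<longlongrightarrow>
          (?c *\<^sub>R q) /\<^sub>R norm (?c *\<^sub>R q)) (admissible_at_top f)"
        unfolding assignment_direction_def
        using ne by (intro tendsto_intros elim) simp
      then show ?case unfolding normalize[OF c] .
    qed
  qed
  from mean direction show ?thesis by blast
qed

end
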